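(* Let $l_1,l_2,l_3\in\mathbb{R}$ be pairwise distinct, let $b_1,b_2,b_3\in\mathbb{R}\setminus\{0\}$, and let $k_4\in\mathbb{R}\setminus\{0\}$. For $q\in(0,1)$ consider the controlled fractional Stokes system on $\mathbb{R}^3$ $$\begin{cases} D_t^q u^1 = (l_2-l_3)u^2u^3 + b_2u^3 - b_3u^2 + k_4u^1,\\ D_t^q u^2 = (l_3-l_1)u^3u^1 + b_3u^1 - b_1u^3 + k_4u^2,\\ D_t^q u^3 = (l_1-l_2)u^1u^2 + b_1u^2 - b_2u^1 + k_4u^3,\end{cases}$$ and its equilibrium state $e_0=(0,0,0)$. (i) If $k_4<0$, then $e_0$ is asymptotically stable for all $q\in(0,1)$. (ii) If $k_4>0$, then $e_0$ is unstable for all $q\in(0,1)$.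
   Context: $u^1,u^2,u^3$ denote the components of $u$ (superscripts are indices, not powers). For $q\in(0,1)$, $D_t^q$ is the Caputo fractional derivative of order $q$: $D_t^q f(t)=\frac{1}{\Gamma(1-q)}\int_0^t (t-s)^{-q}f'(s)\,ds$. For a fractional system $D_t^q x^i(t)=f_i(x^1(t),\dots,x^n(t))$, $i=1,\dots,n$, with $f_i\in C^\infty(\mathbb{R}^n,\mathbb{R})$, a point $x_e\in\mathbb{R}^n$ is an equilibrium state if $f_i(x_e)=0$ for all $i$. The equilibrium state $x_e$ is (locally) stable if for every $\varepsilon>0$ there is $\delta>0$ such that every solution with $\|x(0)-x_e\|<\delta$ satisfies $\|x(t)-x_e\|<\varepsilon$ for all $t>0$; it is (locally) asymptotically stable if it is stable and $\lim_{t\to\infty}\|x(t)-x_e\|=0$ for all solutions starting sufficiently close to $x_e$; it is unstable if it is not stable. Here $\|\cdot\|$ is the Euclidean norm. *)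

theory Defs
  imports "HOL-Analysis.Analysis"
begin

definition caputo_deriv :: "real \<Rightarrow> (real \<Rightarrow> real) \<Rightarrow> real \<Rightarrow> real" where
  "caputo_deriv q f t =
     1 / Gamma (1 - q) * (LINT s:{0<..<t}|lborel. (t - s) powr (-q) * deriv f s)"

text \<open>
  Lebesgue integrals of non-integrable functions are 0 by convention, so a Caputo derivative is only
  meaningful if its defining integral exists.
\<close>

definition caputo_differentiable :: "real \<Rightarrow> (real \<Rightarrow> real) \<Rightarrow> real \<Rightarrow> bool" where
  "caputo_differentiable q f t \<longleftrightarrow>
     set_integrable lborel {0<..<t} (\<lambda>s. (t - s) powr (-q) * deriv f s)"

text \<open>
  A solution lives on the half-line \<open>[0, \<infinity>)\<close>; values at negative times are irrelevant.
  Differentiability and the equation are required only for \<open>t > 0\<close>: the derivative of a typical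
  solution behaves like \<open>t powr (q - 1)\<close> near 0, and at \<open>t = 0\<close> the integral is empty, so the
  equation there would force the initial value to be an equilibrium.
  Integrability of the weighted derivative gives integrability of the derivative itself near 0,
  because the weight is at least \<open>t powr (-q)\<close>; together with continuity at 0, a solution is
  therefore absolutely continuous on bounded intervals.
\<close>

definition caputo_solution ::
    "real \<Rightarrow> (real ^ 'n \<Rightarrow> real ^ 'n) \<Rightarrow> (real \<Rightarrow> real ^ 'n) \<Rightarrow> bool" where
  "caputo_solution q f x \<longleftrightarrow>
     continuous_on {0..} x \<and>
     (\<forall>t>0. x differentiable (at t)) \<and>
     (\<forall>t>0. \<forall>i. caputo_differentiable q (\<lambda>s. x s $ i) t \<and>
                caputo_deriv q (\<lambda>s. x s $ i) t = f (x t) $ i)"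

definition equilibrium_state :: "(real ^ 'n \<Rightarrow> real ^ 'n) \<Rightarrow> real ^ 'n \<Rightarrow> bool" where
  "equilibrium_state f xe \<longleftrightarrow> (\<forall>i. f xe $ i = 0)"

definition stable_equilibrium ::
    "real \<Rightarrow> (real ^ 'n \<Rightarrow> real ^ 'n) \<Rightarrow> real ^ 'n \<Rightarrow> bool" where
  "stable_equilibrium q f xe \<longleftrightarrow>
     equilibrium_state f xe \<and>
     (\<forall>\<epsilon>>0. \<exists>\<delta>>0. \<forall>x. caputo_solution q f x \<and> norm (x 0 - xe) < \<delta> \<longrightarrow>
        (\<forall>t>0. norm (x t - xe) < \<epsilon>))"

definition asymptotically_stable_equilibrium ::
    "real \<Rightarrow> (real ^ 'n \<Rightarrow> real ^ 'n) \<Rightarrow> real ^ 'n \<Rightarrow> bool" where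
  "asymptotically_stable_equilibrium q f xe \<longleftrightarrow>
     stable_equilibrium q f xe \<and>
     (\<exists>\<delta>>0. \<forall>x. caputo_solution q f x \<and> norm (x 0 - xe) < \<delta> \<longrightarrow>
        ((\<lambda>t. norm (x t - xe)) \<longlongrightarrow> 0) at_top)"

definition unstable_equilibrium ::
    "real \<Rightarrow> (real ^ 'n \<Rightarrow> real ^ 'n) \<Rightarrow> real ^ 'n \<Rightarrow> bool" where
  "unstable_equilibrium q f xe \<longleftrightarrow> equilibrium_state f xe \<and> \<not> stable_equilibrium q f xe"

definition stokes_field ::
    "real \<Rightarrow> real \<Rightarrow> real \<Rightarrow> real \<Rightarrow> real \<Rightarrow> real \<Rightarrow> real \<Rightarrow> real ^ 3 \<Rightarrow> real ^ 3" where
  "stokes_field l1 l2 l3 b1 b2 b3 k4 u =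
     vector [(l2 - l3) * u $ 2 * u $ 3 + b2 * u $ 3 - b3 * u $ 2 + k4 * u $ 1,
             (l3 - l1) * u $ 3 * u $ 1 + b3 * u $ 1 - b1 * u $ 3 + k4 * u $ 2,
             (l1 - l2) * u $ 1 * u $ 2 + b1 * u $ 2 - b2 * u $ 1 + k4 * u $ 3]"

end

theory Submission imports Defs begin

text \<open>
  Since \<open>u \<bullet> f u = k4 * (norm u)\<^sup>2\<close>, everything is decided by comparison with scalar barriers. If a
  function attains its maximum over \<open>[0, t]\<close> at \<open>t\<close>, then its Caputo derivative at \<open>t\<close> is
  nonnegative; applied to \<open>e \<bullet> u - G\<close> at the first time where \<open>norm u = G\<close>, with \<open>e\<close> the direction
  of \<open>u\<close>, this shows that \<open>norm u\<close> stays below every \<open>G\<close> with \<open>D\<^sup>q G \<ge> k4 * G\<close>.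

  For \<open>k4 < 0\<close> the constants and the functions \<open>\<eta> + \<kappa> / (1 + a * t)\<close> are such barriers.

  For \<open>k4 > 0\<close> put \<open>\<mu> = k4 powr (1 / q)\<close>. A barrier of size \<open>exp (\<mu> * t)\<close> bounds the solution starting at
  \<open>d * e\<close>, \<open>e = b / norm b\<close>, by \<open>C * d * exp (\<mu> * t)\<close>. The rotation part of the field is orthogonal to \<open>b\<close>,
  so \<open>D\<^sup>q (e \<bullet> u) \<ge> k4 * (e \<bullet> u) - O(d\<^sup>2 * exp (2 * \<mu> * t))\<close>, and a lower barrier forces \<open>e \<bullet> u\<close> up to a
  size independent of \<open>d\<close>. That such a solution exists for all times has to be shown as well: a cutoff
  makes the field Lipschitz, a fixed point argument for the derivative of the Volterra equation
  gives a differentiable solution of the truncated equation, and the growth bound removes the cutoff.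
\<close>

section \<open>Caputo derivatives and the extremum principle\<close>

text \<open>Energy methods usually differentiate \<open>(norm u)\<^sup>2\<close>, but the Caputo
  derivative has no chain rule. Freezing the direction of \<open>u\<close> at the touching time
  keeps the argument linear, and linear functionals do commute with the derivative.

  For \<open>k4 > 0\<close> the direction \<open>b\<close> is dictated by the linearisation at 0,
  whose eigenvalues are k4 and k4 +- i |b|. By the sector criterion for fractional order, a complex
  pair with positive real part can still be stable for small q, since its argument may exceed q pi /
  2. Only the real eigenvalue, with eigenvector \<open>b\<close>, is unstable for every q.

  Stability speaks about solutions on the whole half-line that are differentiable at every t > 0, so
  instability must exhibit one. A continuous solution of the Volterra equation is not enough; hence
  the fixed point argument for the derivative, rescaled by its singularity
  \<open>t powr (q - 1)\<close> at 0. The operator has memory, so a solution cannot be restarted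
  from an endpoint: each horizon is solved from time 0, and the pieces are glued by
  uniqueness.\<close>

definition caputo_op :: "real \<Rightarrow> (real \<Rightarrow> 'a::euclidean_space) \<Rightarrow> real \<Rightarrow> 'a" where
  "caputo_op q v t = (1 / Gamma (1 - q)) *\<^sub>R (LINT s:{0<..<t}|lborel. (t - s) powr (-q) *\<^sub>R v s)"

text \<open>The derivative is carried as a separate argument \<open>v\<close>, so that differences
  and linear images of paths are formed pointwise.\<close>

definition caputo_path ::
    "real \<Rightarrow> (real \<Rightarrow> 'a::euclidean_space) \<Rightarrow> (real \<Rightarrow> 'a) \<Rightarrow> real \<Rightarrow> bool" where
  "caputo_path q u v T \<longleftrightarrow> continuous_on {0..T} u \<and>
     (\<forall>t\<in>{0<..T}. (u has_vector_derivative v t) (at t) \<and>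
        set_integrable lborel {0<..<t} (\<lambda>s. (t - s) powr (-q) *\<^sub>R v s))"

lemma caputo_path_mono: "caputo_path q u v T \<Longrightarrow> S \<le> T \<Longrightarrow> caputo_path q u v S"
  unfolding caputo_path_def by (auto intro: continuous_on_subset)

lemma caputo_path_linear:
  assumes "bounded_linear F" "caputo_path q u v T"
  shows "caputo_path q (\<lambda>t. F (u t)) (\<lambda>t. F (v t)) T"
proof -
  interpret F: bounded_linear F by fact
  have "set_integrable lborel {0<..<t} (\<lambda>s. (t - s) powr (-q) *\<^sub>R F (v s))"
    if "set_integrable lborel {0<..<t} (\<lambda>s. (t - s) powr (-q) *\<^sub>R v s)" for t
    using integrable_bounded_linear[OF assms(1) that[unfolded set_integrable_def]]
    by (simp add: set_integrable_def F.scaleR)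
  then show ?thesis
    using assms(2) unfolding caputo_path_def
    by (auto intro: F.continuous_on F.has_vector_derivative)
qed

lemma caputo_op_linear:
  assumes "bounded_linear F" "caputo_path q u v T" "t \<in> {0<..T}"
  shows "caputo_op q (\<lambda>t. F (v t)) t = F (caputo_op q v t)"
proof -
  interpret F: bounded_linear F by fact
  have int: "set_integrable lborel {0<..<t} (\<lambda>s. (t - s) powr (-q) *\<^sub>R v s)"
    using assms(2,3) unfolding caputo_path_def by auto
  have "(LINT s:{0<..<t}|lborel. (t - s) powr (-q) *\<^sub>R F (v s)) =
      F (LINT s:{0<..<t}|lborel. (t - s) powr (-q) *\<^sub>R v s)"
    unfolding set_lebesgue_integral_def F.scaleR[symmetric]
    by (rule integral_bounded_linear[OF assms(1) int[unfolded set_integrable_def]])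
  then show ?thesis by (simp add: caputo_op_def F.scaleR)
qed

lemma caputo_path_diff:
  assumes "caputo_path q u v T" "caputo_path q u' v' T"
  shows "caputo_path q (\<lambda>t. u t - u' t) (\<lambda>t. v t - v' t) T"
  using assms unfolding caputo_path_def
  by (auto intro!: continuous_intros has_vector_derivative_diff set_integral_diff(1)
      simp: scaleR_diff_right)

lemma caputo_op_diff:
  assumes "caputo_path q u v T" "caputo_path q u' v' T" "t \<in> {0<..T}"
  shows "caputo_op q (\<lambda>t. v t - v' t) t = caputo_op q v t - caputo_op q v' t"
  using assms unfolding caputo_path_def caputo_op_def
  by (auto simp: scaleR_diff_right set_integral_diff(2))

text \<open>
  Integration by parts with \<open>(t - s) powr (-q) * (\<phi> s - \<phi> t)\<close>, whose boundary term at \<open>s = t\<close>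
  vanishes because \<open>\<phi>\<close> is differentiable there.
\<close>

lemma caputo_op_pos_at_max:
  fixes \<phi> v :: "real \<Rightarrow> real"
  assumes q: "0 < q" "q < 1" and t: "0 < t" and path: "caputo_path q \<phi> v t"
    and max: "\<And>s. s \<in> {0..t} \<Longrightarrow> \<phi> s \<le> \<phi> t" and less: "\<phi> 0 < \<phi> t"
  shows "0 < caputo_op q v t"
proof -
  define h where "h s = (t - s) powr (-q) * (\<phi> s - \<phi> t)" for s
  define w where "w s = (t - s) powr (-q) * v s" for s
  define h' where "h' s = w s + q * (t - s) powr (-q-1) * (\<phi> s - \<phi> t)" for s
  have der: "(\<phi> has_real_derivative v s) (at s)" if "s \<in> {0<..t}" for s
    using path that unfolding caputo_path_def has_real_derivative_iff_has_vector_derivative by auto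
  have cont\<phi>: "continuous_on {0..t} \<phi>" using path by (simp add: caputo_path_def)
  have int: "set_integrable lborel {0<..<t} w"
    using path t unfolding caputo_path_def w_def by auto
  have "continuous_on {0..t} h"
    unfolding continuous_on_eq_continuous_within
  proof
    fix s assume s: "s \<in> {0..t}"
    show "continuous (at s within {0..t}) h"
    proof (cases "s = t")
      case False
      then show ?thesis using s cont\<phi> unfolding h_def
        by (intro continuous_intros) (auto simp: continuous_on_eq_continuous_within eventually_at_filter)
    next
      case True
      have 1: "((\<lambda>s. (\<phi> s - \<phi> t) / (s - t)) \<longlongrightarrow> v t) (at t within {0..t})"
        using der[of t] t by (auto simp: has_field_derivative_iff intro: tendsto_within_subset)
      have "((\<lambda>s. (t - s) powr (1 - q)) \<longlongrightarrow> (t - t) powr (1 - q)) (at t within {0..t})"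
        by (rule tendsto_powr') (use q in \<open>auto intro!: tendsto_eq_intros simp: eventually_at_filter\<close>)
      then have "((\<lambda>s. (\<phi> s - \<phi> t) / (s - t) * - ((t - s) powr (1 - q))) \<longlongrightarrow> v t * - 0) (at t within {0..t})"
        by (intro tendsto_intros 1) auto
      moreover have "eventually (\<lambda>s. (\<phi> s - \<phi> t) / (s - t) * - ((t - s) powr (1 - q)) = h s) (at t within {0..t})"
        unfolding eventually_at_filter
      proof (rule always_eventually, intro allI impI)
        fix s assume "s \<noteq> t" "s \<in> {0..t}"
        then have "(t - s) powr (1 - q) = (t - s) * (t - s) powr (-q)"
          using powr_mult_base[of "t - s" "-q"] by simp
        then show "(\<phi> s - \<phi> t) / (s - t) * - ((t - s) powr (1 - q)) = h s"
          using \<open>s \<noteq> t\<close> by (simp add: h_def divide_simps) (simp add: algebra_simps)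
      qed
      ultimately have "(h \<longlongrightarrow> v t * - 0) (at t within {0..t})"
        by (rule Lim_transform_eventually)
      then show ?thesis using True by (simp add: continuous_within h_def)
    qed
  qed
  moreover have "(h has_vector_derivative h' s) (at s)" if "s \<in> {0<..<t}" for s
  proof -
    have "(h has_real_derivative h' s) (at s)"
      unfolding h_def h'_def w_def
      by (rule derivative_eq_intros der refl | use that in \<open>simp; fail\<close>)+
    then show ?thesis by (simp add: has_real_derivative_iff_has_vector_derivative)
  qed
  \<comment> \<open>The fundamental theorem gives the gauge integral of \<open>h'\<close> in spite
    of its singular second summand; the comparison with \<open>w\<close> is therefore made between
    gauge integrals.\<close>
  ultimately have "(h' has_integral (h t - h 0)) {0..t}"
    by (intro fundamental_theorem_of_calculus_interior) (use t in auto)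
  then have h': "(h' has_integral (h t - h 0)) {0<..<t}"
    using has_integral_Icc_iff_Ioo by blast
  have w: "(w has_integral (LINT s:{0<..<t}|lborel. w s)) {0<..<t}"
    using int by (simp add: set_borel_integral_eq_integral integrable_integral)
  \<comment> \<open>\<open>h'\<close> is at most \<open>w\<close> because \<open>\<phi>\<close>
    peaks at \<open>t\<close>. Strict positivity comes from the boundary term at 0 alone, where
    \<open>\<phi> 0 < \<phi> t\<close> enters.\<close>
  have "h t - h 0 \<le> (LINT s:{0<..<t}|lborel. w s)"
    by (rule has_integral_le[OF h' w]) (use q max in \<open>auto simp: h'_def intro!: mult_nonneg_nonpos\<close>)
  moreover have "h t - h 0 > 0" using less t by (simp add: h_def mult_pos_neg)
  ultimately show ?thesis using q
    by (auto simp: caputo_op_def w_def intro!: mult_pos_pos Gamma_real_pos)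
qed

text \<open>\<open>s\<close> is the least point of the compact set where \<open>f\<close> is
  nonnegative; a positive value there would yield an earlier zero by the intermediate value
  theorem.\<close>

lemma first_zero:
  fixes f :: "real \<Rightarrow> real"
  assumes "continuous_on {0..T} f" "f 0 < 0" "t \<in> {0..T}" "0 \<le> f t"
  obtains s where "s \<in> {0<..T}" "f s = 0" "\<And>r. r \<in> {0..<s} \<Longrightarrow> f r < 0"
proof -
  define S where "S = {x \<in> {0..T}. 0 \<le> f x}"
  have "S = {0..T} \<inter> f -` {0..}" by (auto simp: S_def)
  then have "closed S" using continuous_closed_preimage[OF assms(1), of "{0..}"] by simp
  moreover have "bounded S" by (rule bounded_subset[of "{0..T}"]) (auto simp: S_def)
  ultimately have S: "compact S" "S \<noteq> {}"
    using assms by (auto simp: compact_eq_bounded_closed S_def)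
  obtain s where s: "s \<in> S" "\<And>r. r \<in> S \<Longrightarrow> s \<le> r"
    using compact_attains_inf[OF S] by blast
  have less: "f r < 0" if "r \<in> {0..<s}" for r
    using s that by (force simp: S_def)
  have "f s \<le> 0"
  proof (rule ccontr)
    assume "\<not> f s \<le> 0"
    moreover have "continuous_on {0..s} f"
      using assms(1) s(1) by (auto simp: S_def intro: continuous_on_subset)
    ultimately obtain x where "0 \<le> x" "x \<le> s" "f x = 0"
      using IVT'[of f 0 0 s] assms(2) s(1) by (auto simp: S_def)
    then have "x = s" using s by (fastforce simp: S_def)
    with \<open>f x = 0\<close> \<open>\<not> f s \<le> 0\<close> show False by simp
  qed
  then show thesis
    using s assms(2) less by (intro that[of s]) (auto simp: S_def order.order_iff_strict)
qed

text \<open>At its first zero \<open>\<phi>\<close> attains a maximum over the past and exceeds its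
  initial value, so its derivative is strictly positive there, against \<open>touch\<close>. The
  parameter \<open>\<tau>\<close> lets the sign on an initial interval be supplied by other
  means.\<close>

lemma caputo_neg_comparison:
  fixes \<phi> v :: "real \<Rightarrow> real"
  assumes q: "0 < q" "q < 1" and path: "caputo_path q \<phi> v T" and "0 \<le> \<tau>"
    and init: "\<And>t. t \<in> {0..T} \<Longrightarrow> t \<le> \<tau> \<Longrightarrow> \<phi> t < 0"
    and touch: "\<And>t. t \<in> {\<tau><..T} \<Longrightarrow> \<phi> t = 0 \<Longrightarrow> caputo_op q v t \<le> 0"
    and t: "t \<in> {0..T}"
  shows "\<phi> t < 0"
proof (rule ccontr)
  assume "\<not> \<phi> t < 0"
  with t path init \<open>0 \<le> \<tau>\<close> obtain s where s: "s \<in> {0<..T}" "\<phi> s = 0" "\<And>r. r \<in> {0..<s} \<Longrightarrow> \<phi> r < 0"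
    by (auto simp: caputo_path_def intro: first_zero[of T \<phi> t])
  have "\<tau> < s" using init[of s] s(1,2) by (cases "s \<le> \<tau>") auto
  then have "caputo_op q v s \<le> 0" using touch s by auto
  moreover have "0 < caputo_op q v s"
    using s by (intro caputo_op_pos_at_max[OF q _ caputo_path_mono[OF path]])
      (auto simp: order.order_iff_strict)
  ultimately show False by simp
qed

text \<open>
  At the first time \<open>s\<close> where \<open>norm (u s) = G s\<close>, the scalar function \<open>sgn (u s) \<bullet> u - G\<close>
  attains its maximum over \<open>{0..s}\<close>; the norm of \<open>u\<close> itself need not be differentiable.
\<close>

lemma caputo_norm_comparison:
  fixes u v :: "real \<Rightarrow> 'a::euclidean_space" and G g :: "real \<Rightarrow> real"
  assumes q: "0 < q" "q < 1" and path: "caputo_path q u v T" "caputo_path q G g T" and "0 \<le> \<tau>"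
    and pos: "\<And>t. t \<in> {0..T} \<Longrightarrow> 0 < G t"
    and init: "\<And>t. t \<in> {0..T} \<Longrightarrow> t \<le> \<tau> \<Longrightarrow> norm (u t) < G t"
    and touch: "\<And>t. t \<in> {\<tau><..T} \<Longrightarrow> norm (u t) = G t \<Longrightarrow>
      u t \<bullet> caputo_op q v t \<le> G t * caputo_op q g t"
    and t: "t \<in> {0..T}"
  shows "norm (u t) < G t"
proof (rule ccontr)
  assume *: "\<not> norm (u t) < G t"
  have "continuous_on {0..T} (\<lambda>t. norm (u t) - G t)"
    using path by (auto simp: caputo_path_def intro: continuous_intros)
  with * t init[of 0] \<open>0 \<le> \<tau>\<close> obtain s where s: "s \<in> {0<..T}" "norm (u s) = G s"
      "\<And>r. r \<in> {0..<s} \<Longrightarrow> norm (u r) < G r"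
    by (auto elim!: first_zero[of T _ t])
  have "\<tau> < s" using init[of s] s(1,2) by (cases "s \<le> \<tau>") auto
  then have le: "u s \<bullet> caputo_op q v s \<le> G s * caputo_op q g s" using touch s by auto
  have Gs: "0 < G s" using pos s(1) by auto
  define e where "e = sgn (u s)"
  have e: "norm e = 1" "u s = G s *\<^sub>R e" "e \<bullet> u s = G s"
    using Gs s(2) unfolding e_def
    by (auto simp: norm_sgn sgn_div_norm power2_norm_eq_inner[symmetric] power2_eq_square)
  have path1: "caputo_path q (\<lambda>t. e \<bullet> u t) (\<lambda>t. e \<bullet> v t) T"
    by (rule caputo_path_linear[OF bounded_linear_inner_right path(1)])
  note path2 = caputo_path_diff[OF path1 path(2)]
  have "0 < caputo_op q (\<lambda>t. e \<bullet> v t - g t) s"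
  proof (rule caputo_op_pos_at_max[OF q _ caputo_path_mono[OF path2]])
    have *: "e \<bullet> u r - G r < 0" if "r \<in> {0..<s}" for r
      using norm_cauchy_schwarz[of e "u r"] s(3)[OF that] e(1) by simp
    show "e \<bullet> u 0 - G 0 < e \<bullet> u s - G s" using *[of 0] s(1) e(3) by simp
    show "e \<bullet> u r - G r \<le> e \<bullet> u s - G s" if "r \<in> {0..s}" for r
      using *[of r] e(3) that by (cases "r = s") auto
  qed (use s(1) in auto)
  also have "\<dots> = e \<bullet> caputo_op q v s - caputo_op q g s"
    using caputo_op_diff[OF path1 path(2) s(1)]
      caputo_op_linear[OF bounded_linear_inner_right path(1) s(1)] by simp
  finally have "G s * caputo_op q g s < G s * (e \<bullet> caputo_op q v s)"
    using Gs by simp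
  also have "\<dots> = u s \<bullet> caputo_op q v s" using e(2) by (metis inner_scaleR_left)
  finally show False using le by simp
qed

section \<open>Caputo derivatives of the barriers\<close>

text \<open>Bridge from the gauge integrals in which Beta and Gamma are evaluated to Lebesgue
  integrals; for nonnegative functions the two notions agree.\<close>

lemma set_integrable_lborel_nonneg:
  fixes f :: "'a::euclidean_space \<Rightarrow> real"
  assumes "(f has_integral I) S" "S \<in> sets borel" "f \<in> borel_measurable borel"
    and "\<And>x. x \<in> S \<Longrightarrow> 0 \<le> f x"
  shows "set_integrable lborel S f" "(LINT x:S|lborel. f x) = I"
proof -
  have "f absolutely_integrable_on S"
    using assms by (intro nonnegative_absolutely_integrable_1) (auto simp: integrable_on_def)
  then show *: "set_integrable lborel S f"
    using assms(2,3) unfolding set_integrable_def by (subst (asm) integrable_completion) auto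
  show "(LINT x:S|lborel. f x) = I"
    using assms(1) set_borel_integral_eq_integral(2)[OF *] by (simp add: integral_unique)
qed

lemma
  fixes h :: "real \<Rightarrow> 'a::euclidean_space"
  assumes "r < t"
  shows set_integrable_Ioo_rescale: "set_integrable lborel {r<..<t} h \<longleftrightarrow>
      set_integrable lborel {0<..<1} (\<lambda>x. h (r + (t - r) * x))" (is ?A)
    and set_integral_Ioo_rescale: "(LINT s:{r<..<t}|lborel. h s) =
      (t - r) *\<^sub>R (LINT x:{0<..<1}|lborel. h (r + (t - r) * x))" (is ?B)
proof -
  have ind: "indicator {r<..<t} (r + (t - r) * x) = (indicator {0<..<1} x :: real)" for x
  proof -
    have "r + (t - r) * x < t \<longleftrightarrow> (t - r) * x < (t - r) * 1" by auto
    also have "\<dots> \<longleftrightarrow> x < 1" using assms by (subst mult_less_cancel_left_pos) auto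
    finally show ?thesis using assms by (simp add: indicator_def zero_less_mult_iff)
  qed
  show ?A
    using lborel_integrable_real_affine_iff[of "t - r" "\<lambda>s. indicator {r<..<t} s *\<^sub>R h s" r] assms
    by (simp add: set_integrable_def ind)
  show ?B
    using lborel_integral_real_affine[of "t - r" "\<lambda>s. indicator {r<..<t} s *\<^sub>R h s" r] assms
    by (simp add: set_lebesgue_integral_def ind)
qed

lemma
  fixes a b :: real
  assumes "0 < a" "0 < b"
  shows set_integrable_Beta01: "set_integrable lborel {0<..<1} (\<lambda>x. x powr (a - 1) * (1 - x) powr (b - 1))"
    and set_integral_Beta01: "(LINT x:{0<..<1}|lborel. x powr (a - 1) * (1 - x) powr (b - 1)) = Beta a b"
proof -
  have "((\<lambda>x. x powr (a - 1) * (1 - x) powr (b - 1)) has_integral Beta a b) {0<..<1}"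
    using has_integral_Beta_real[OF assms] has_integral_Icc_iff_Ioo by blast
  from set_integrable_lborel_nonneg[OF this]
  show "set_integrable lborel {0<..<1} (\<lambda>x. x powr (a - 1) * (1 - x) powr (b - 1))"
    "(LINT x:{0<..<1}|lborel. x powr (a - 1) * (1 - x) powr (b - 1)) = Beta a b"
    by auto
qed

text \<open>The convolution of two power kernels. For exponents \<open>q\<close> and
  \<open>1 - q\<close> the power of \<open>t - r\<close> becomes 1, and this is what later makes the
  Caputo derivative undo the fractional integral.\<close>

lemma
  fixes a b r t :: real
  assumes "0 < a" "0 < b" "r < t"
  shows set_integrable_Beta_Ioo:
      "set_integrable lborel {r<..<t} (\<lambda>s. (t - s) powr (b - 1) * (s - r) powr (a - 1))" (is ?A)
    and set_integral_Beta_Ioo: "(LINT s:{r<..<t}|lborel. (t - s) powr (b - 1) * (s - r) powr (a - 1)) =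
      (t - r) powr (a + b - 1) * Beta a b" (is ?B)
proof -
  have eq: "(t - (r + (t - r) * x)) powr (b - 1) * ((r + (t - r) * x) - r) powr (a - 1) =
      (t - r) powr (a + b - 2) * (x powr (a - 1) * (1 - x) powr (b - 1))" if "x \<in> {0<..<1}" for x
  proof -
    have "t - (r + (t - r) * x) = (t - r) * (1 - x)" by (simp add: algebra_simps)
    moreover have "(t - r) powr (a + b - 2) = (t - r) powr (b - 1) * (t - r) powr (a - 1)"
      by (simp add: powr_add[symmetric] add.commute)
    ultimately show ?thesis using that assms by (simp add: powr_mult)
  qed
  show ?A
    unfolding set_integrable_Ioo_rescale[OF assms(3)]
    using set_integrable_Beta01[OF assms(1,2)]
    by (subst set_integrable_cong[OF refl refl eq]) auto
  have "(LINT x:{0<..<1}|lborel. (t - (r + (t - r) * x)) powr (b - 1) * ((r + (t - r) * x) - r) powr (a - 1)) =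
      (LINT x:{0<..<1}|lborel. (t - r) powr (a + b - 2) * (x powr (a - 1) * (1 - x) powr (b - 1)))"
    using eq by (intro set_lebesgue_integral_cong) auto
  then have "(LINT s:{r<..<t}|lborel. (t - s) powr (b - 1) * (s - r) powr (a - 1)) =
      (t - r) * ((t - r) powr (a + b - 2) * Beta a b)"
    unfolding set_integral_Ioo_rescale[OF assms(3)] set_integral_mult_right
    by (simp add: set_integral_Beta01[OF assms(1,2)])
  also have "\<dots> = (t - r) powr (a + b - 1) * Beta a b"
    using powr_mult_base[of "t - r" "a + b - 2"] assms(3) by (simp add: add.commute add_diff_eq)
  finally show ?B .
qed

lemma Beta_one_minus: "Beta q (1 - q) = Gamma q * Gamma (1 - q :: real)"
  by (simp add: Beta_def)

lemma set_integrable_powr_kernel: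
  fixes q t :: real
  assumes "0 < q" "q < 1" "0 < t"
  shows "set_integrable lborel {0<..<t} (\<lambda>s. (t - s) powr (-q))"
  using set_integrable_Beta_Ioo[of 1 "1 - q" 0 t] assms
  by (auto elim!: set_integrable_cong[THEN iffD1, rotated -1])

lemma set_integrable_kernel_bounded:
  fixes q t :: real and v :: "real \<Rightarrow> 'a::euclidean_space"
  assumes "0 < q" "q < 1" "0 < t" "continuous_on {0..t} v"
  shows "set_integrable lborel {0<..<t} (\<lambda>s. (t - s) powr (-q) *\<^sub>R v s)"
proof -
  obtain B where B: "\<And>s. s \<in> {0..t} \<Longrightarrow> norm (v s) \<le> B"
    using compact_imp_bounded[OF compact_continuous_image[OF assms(4)]] by (force simp: bounded_iff)
  have "set_borel_measurable borel {0<..<t} v"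
    using continuous_on_subset[OF assms(4)]
    by (auto intro!: borel_measurable_continuous_on_indicator simp: set_borel_measurable_def greaterThanLessThan_subseteq_atLeastAtMost_iff)
  then have "(\<lambda>s. (t - s) powr (-q) *\<^sub>R (indicator {0<..<t} s *\<^sub>R v s)) \<in> borel_measurable borel"
    unfolding set_borel_measurable_def by measurable
  then have m: "set_borel_measurable lborel {0<..<t} (\<lambda>s. (t - s) powr (-q) *\<^sub>R v s)"
    by (simp add: set_borel_measurable_def mult.commute)
  have i: "set_integrable lborel {0<..<t} (\<lambda>s. B * (t - s) powr (-q))"
    using set_integrable_powr_kernel[OF assms(1-3)] by (intro set_integrable_mult_right) auto
  show ?thesis
    by (rule set_integrable_bound[OF i m])
      (auto intro!: AE_I2 order.trans[OF _ abs_ge_self] mult_mono simp: mult.commute[of B] B less_imp_le)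
qed

section \<open>Constants, powers and hyperbolic decay\<close>

lemma
  shows caputo_path_const: "caputo_path q (\<lambda>_. c) (\<lambda>_. 0) T"
    and caputo_op_const: "caputo_op q (\<lambda>_. 0) t = 0"
  by (auto simp: caputo_path_def caputo_op_def set_integrable_def set_lebesgue_integral_def)

text \<open>For order \<open>q\<close> this power plays the role of the identity function: its
  derivative is constant, and in particular does not vanish as \<open>t\<close> tends to 0.\<close>

lemma
  assumes q: "0 < q" "q < 1"
  shows caputo_path_powr: "caputo_path q (\<lambda>t. t powr q) (\<lambda>t. q * t powr (q - 1)) T"
    and caputo_op_powr: "0 < t \<Longrightarrow> caputo_op q (\<lambda>t. q * t powr (q - 1)) t = Gamma (1 + q)"
proof -
  have int: "set_integrable lborel {0<..<t} (\<lambda>s. (t - s) powr (-q) *\<^sub>R (q * s powr (q - 1)))"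
    if "0 < t" for t
  proof -
    have "set_integrable lborel {0<..<t} (\<lambda>s. q * ((t - s) powr (1 - q - 1) * (s - 0) powr (q - 1)))"
      using set_integrable_Beta_Ioo[of q "1 - q" 0 t] that q by (intro set_integrable_mult_right) auto
    then show ?thesis by (simp add: mult.left_commute)
  qed
  have "continuous_on {0..T} (\<lambda>t. t powr q)"
    using q by (intro continuous_on_powr' continuous_intros) auto
  moreover have "((\<lambda>t. t powr q) has_vector_derivative q * t powr (q - 1)) (at t)" if "0 < t" for t
    unfolding has_real_derivative_iff_has_vector_derivative[symmetric]
    using that by (auto intro!: derivative_eq_intros)
  ultimately show "caputo_path q (\<lambda>t. t powr q) (\<lambda>t. q * t powr (q - 1)) T"
    using int by (auto simp: caputo_path_def)
  show "caputo_op q (\<lambda>t. q * t powr (q - 1)) t = Gamma (1 + q)" if "0 < t"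
  proof -
    have "(LINT s:{0<..<t}|lborel. q * ((t - s) powr (1 - q - 1) * (s - 0) powr (q - 1))) =
        q * Beta q (1 - q)"
      using that q set_integral_Beta_Ioo[of q "1 - q" 0 t] by (subst set_integral_mult_right) simp
    then have "(LINT s:{0<..<t}|lborel. (t - s) powr (-q) * (q * s powr (q - 1))) = q * Beta q (1 - q)"
      by (simp add: mult.left_commute)
    moreover have "Gamma (1 - q) > 0" using q by (intro Gamma_real_pos) auto
    moreover have "Gamma (1 + q) = q * Gamma q"
    proof -
      have "q \<notin> \<int>\<^sub>\<le>\<^sub>0" using q by (auto simp: nonpos_Ints_def)
      then show ?thesis using Gamma_plus1[of q] by (simp add: add.commute)
    qed
    ultimately show ?thesis by (simp add: caputo_op_def Beta_one_minus)
  qed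
qed

text \<open>
  Since \<open>(1 + a * s) powr (-2) \<le> (a * s) powr (q - 1)\<close>, the fractional derivative is bounded by a
  Beta integral that does not depend on \<open>t\<close>.
\<close>

lemma
  fixes a q :: real
  assumes q: "0 < q" "q < 1" and a: "0 < a"
  shows caputo_path_decay: "caputo_path q (\<lambda>t. inverse (1 + a * t)) (\<lambda>t. - a / (1 + a * t)\<^sup>2) T"
    and caputo_op_decay: "0 < t \<Longrightarrow> - (a powr q * Gamma q) \<le> caputo_op q (\<lambda>t. - a / (1 + a * t)\<^sup>2) t"
proof -
  have ne: "1 + a * s \<noteq> 0" if "0 \<le> s" for s
    using mult_nonneg_nonneg[of a s] a that by linarith
  have cont: "continuous_on {0..t} (\<lambda>t. - a / (1 + a * t)\<^sup>2)" for t
    using ne by (intro continuous_intros) auto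
  have int: "set_integrable lborel {0<..<t} (\<lambda>s. (t - s) powr (-q) *\<^sub>R (- a / (1 + a * s)\<^sup>2))"
    if "0 < t" for t
    by (rule set_integrable_kernel_bounded[OF q that cont])
  have "continuous_on {0..T} (\<lambda>t. inverse (1 + a * t))"
    using ne by (intro continuous_intros) auto
  moreover have "((\<lambda>t. inverse (1 + a * t)) has_vector_derivative - a / (1 + a * t)\<^sup>2) (at t)"
    if "0 < t" for t
    unfolding has_real_derivative_iff_has_vector_derivative[symmetric]
    using ne[of t] that by (auto intro!: derivative_eq_intros simp: field_simps power2_eq_square)
  ultimately show "caputo_path q (\<lambda>t. inverse (1 + a * t)) (\<lambda>t. - a / (1 + a * t)\<^sup>2) T"
    using int by (auto simp: caputo_path_def)
  show "- (a powr q * Gamma q) \<le> caputo_op q (\<lambda>t. - a / (1 + a * t)\<^sup>2) t" if t: "0 < t"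
  proof -
    have G: "Gamma (1 - q) > 0" using q by (intro Gamma_real_pos) auto
    have "(LINT s:{0<..<t}|lborel. - (a powr q) * ((t - s) powr (1 - q - 1) * (s - 0) powr (q - 1))) \<le>
        (LINT s:{0<..<t}|lborel. (t - s) powr (-q) *\<^sub>R (- a / (1 + a * s)\<^sup>2))"
    proof (rule set_integral_mono)
      show "set_integrable lborel {0<..<t} (\<lambda>s. - (a powr q) * ((t - s) powr (1 - q - 1) * (s - 0) powr (q - 1)))"
        using q t set_integrable_Beta_Ioo[of q "1 - q" 0 t]
        by (intro set_integrable_mult_right) auto
      show "set_integrable lborel {0<..<t} (\<lambda>s. (t - s) powr (-q) *\<^sub>R (- a / (1 + a * s)\<^sup>2))"
        by (rule int[OF t])
      fix s assume s: "s \<in> {0<..<t}"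
      then have pos: "0 < a * s" using a by simp
      have "1 / (1 + a * s)\<^sup>2 = (1 + a * s) powr (-2)"
        using pos by (simp add: powr_minus divide_simps powr_numeral)
      also have "\<dots> \<le> (1 + a * s) powr (q - 1)"
        using pos q by (intro powr_mono) auto
      also have "\<dots> \<le> (a * s) powr (q - 1)"
        using pos q by (intro powr_mono2') auto
      finally have "a / (1 + a * s)\<^sup>2 \<le> a * (a * s) powr (q - 1)"
        using a mult_left_mono[of "1 / (1 + a * s)\<^sup>2" "(a * s) powr (q - 1)" a] by simp
      also have "\<dots> = a powr q * s powr (q - 1)"
        using a s powr_mult_base[of a "q - 1"] by (simp add: powr_mult)
      finally have "(t - s) powr (-q) * (a / (1 + a * s)\<^sup>2) \<le> (t - s) powr (-q) * (a powr q * s powr (q - 1))"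
        by (intro mult_left_mono) auto
      then show "- (a powr q) * ((t - s) powr (1 - q - 1) * (s - 0) powr (q - 1)) \<le>
          (t - s) powr (-q) *\<^sub>R (- a / (1 + a * s)\<^sup>2)"
        by (simp add: mult.left_commute)
    qed
    moreover have "(LINT s:{0<..<t}|lborel. - (a powr q) * ((t - s) powr (1 - q - 1) * (s - 0) powr (q - 1))) =
        - (a powr q * Beta q (1 - q))"
      using t q set_integral_Beta_Ioo[of q "1 - q" 0 t]
      by (subst set_integral_mult_right) simp
    ultimately have "- (a powr q * Gamma q * Gamma (1 - q)) \<le>
        (LINT s:{0<..<t}|lborel. (t - s) powr (-q) *\<^sub>R (- a / (1 + a * s)\<^sup>2))"
      by (simp add: Beta_one_minus)
    then have "- (a powr q * Gamma q * Gamma (1 - q)) / Gamma (1 - q) \<le> caputo_op q (\<lambda>t. - a / (1 + a * t)\<^sup>2) t"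
      unfolding caputo_op_def using divide_right_mono[OF _ less_imp_le[OF G]] by fastforce
    then show ?thesis using G by simp
  qed
qed

section \<open>Exponentials and the Laplace transform of the kernel\<close>

lemma Gamma_integral_Ioi:
  fixes p \<sigma> :: real
  assumes "0 < p" "0 < \<sigma>"
  shows "set_integrable lborel {0<..} (\<lambda>x. x powr (p - 1) * exp (- \<sigma> * x))"
    and "(LINT x:{0<..}|lborel. x powr (p - 1) * exp (- \<sigma> * x)) = \<sigma> powr (-p) * Gamma p"
proof -
  have "((\<lambda>t. t powr (p - 1) / exp t) has_integral Gamma p) {0<..}"
    using Gamma_integral_real[OF assms(1)]
    by (rule has_integral_spike_set_eq[THEN iffD1, rotated -1]) (auto intro: negligible_subset[of "{0}"])
  note * = set_integrable_lborel_nonneg[OF this]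
  define f where "f t = indicator {0<..} t * (t powr (p - 1) / exp t)" for t :: real
  have f: "integrable lborel f" "integral\<^sup>L lborel f = Gamma p"
    using * by (auto simp: f_def[abs_def] set_integrable_def set_lebesgue_integral_def)
  have eq: "indicator {0<..} x *\<^sub>R (x powr (p - 1) * exp (- \<sigma> * x)) = \<sigma> powr (1 - p) * f (0 + \<sigma> * x)" for x
    using assms by (auto simp: f_def powr_mult exp_minus field_simps powr_diff split: split_indicator
        simp: zero_less_mult_iff)
  show "set_integrable lborel {0<..} (\<lambda>x. x powr (p - 1) * exp (- \<sigma> * x))"
    unfolding set_integrable_def eq using lborel_integrable_real_affine[OF f(1), of \<sigma> 0] assms by simp
  have "Gamma p = \<sigma> * (LINT x|lborel. f (0 + \<sigma> * x))"
    using lborel_integral_real_affine[of \<sigma> f 0] f(2) assms by simp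
  then have "\<sigma> powr (-p) * Gamma p = \<sigma> powr (1 - p) * (LINT x|lborel. f (0 + \<sigma> * x))"
    using powr_mult_base[of \<sigma> "-p"] assms by (simp add: mult_ac)
  then show "(LINT x:{0<..}|lborel. x powr (p - 1) * exp (- \<sigma> * x)) = \<sigma> powr (-p) * Gamma p"
    unfolding set_lebesgue_integral_def eq by simp
qed

lemma caputo_path_exp:
  fixes q \<sigma> :: real
  assumes "0 < q" "q < 1"
  shows "caputo_path q (\<lambda>t. exp (\<sigma> * t)) (\<lambda>t. \<sigma> * exp (\<sigma> * t)) T"
proof -
  have "set_integrable lborel {0<..<t} (\<lambda>s. (t - s) powr (-q) *\<^sub>R (\<sigma> * exp (\<sigma> * s)))" if "0 < t" for t
    using assms that by (intro set_integrable_kernel_bounded continuous_intros) auto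
  then show ?thesis
    unfolding caputo_path_def has_real_derivative_iff_has_vector_derivative[symmetric]
    by (auto intro!: continuous_intros derivative_eq_intros)
qed

text \<open>
  Substituting \<open>x = t - s\<close>, the defect \<open>\<sigma>\<^sup>q exp (\<sigma> t) - D\<^sup>q exp (\<sigma> t)\<close> is, up to a constant, the
  integral of \<open>(t + x) powr (-q) * exp (- \<sigma> x)\<close> over \<open>x > 0\<close>, which decreases in \<open>t\<close>.
\<close>

lemma caputo_op_exp_defect:
  fixes q \<sigma> :: real
  assumes q: "0 < q" "q < 1" and \<sigma>: "0 < \<sigma>" and t: "0 < t"
  shows "set_integrable lborel {0<..} (\<lambda>x. (t + x) powr (-q) * exp (- \<sigma> * x))"
    and "caputo_op q (\<lambda>t. \<sigma> * exp (\<sigma> * t)) t = \<sigma> powr q * exp (\<sigma> * t) -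
      \<sigma> / Gamma (1 - q) * (LINT x:{0<..}|lborel. (t + x) powr (-q) * exp (- \<sigma> * x))"
proof -
  define f where "f x = x powr (-q) * exp (- \<sigma> * x)" for x :: real
  have f: "set_integrable lborel {0<..} f" "(LINT x:{0<..}|lborel. f x) = \<sigma> powr (q - 1) * Gamma (1 - q)"
    using Gamma_integral_Ioi[of "1 - q" \<sigma>] q \<sigma> by (auto simp: f_def[abs_def])
  have f1: "set_integrable lborel {0<..<t} f" and f2: "set_integrable lborel {t<..} f"
      and f3: "set_integrable lborel {t..} f"
    using t by (auto intro!: set_integrable_subset[OF f(1)])
  have tail: "indicator {t<..} (t + 1 * x) *\<^sub>R f (t + 1 * x) =
      exp (- \<sigma> * t) * (indicator {0<..} x *\<^sub>R ((t + x) powr (-q) * exp (- \<sigma> * x)))" for x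
    by (auto simp: f_def exp_add[symmetric] algebra_simps split: split_indicator)
  have "integrable lborel (\<lambda>x. exp (- \<sigma> * t) * (indicator {0<..} x *\<^sub>R ((t + x) powr (-q) * exp (- \<sigma> * x))))"
    using lborel_integrable_real_affine[OF f2[unfolded set_integrable_def], of 1 t] unfolding tail by simp
  then show "set_integrable lborel {0<..} (\<lambda>x. (t + x) powr (-q) * exp (- \<sigma> * x))"
    unfolding set_integrable_def by (subst (asm) integrable_mult_left_iff) auto
  have "(LINT x:{t..}|lborel. f x) = (LINT x:{t<..}|lborel. f x)"
    unfolding set_lebesgue_integral_def
  proof (rule integral_cong_AE)
    show "AE x in lborel. indicator {t..} x *\<^sub>R f x = indicator {t<..} x *\<^sub>R f x"
      using AE_lborel_singleton[of t] by eventually_elim (auto split: split_indicator)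
  qed (use f2 f3 in \<open>auto simp: set_integrable_def\<close>)
  also have "\<dots> = exp (- \<sigma> * t) * (LINT x:{0<..}|lborel. (t + x) powr (-q) * exp (- \<sigma> * x))"
    using lborel_integral_real_affine[of 1 "\<lambda>x. indicator {t<..} x *\<^sub>R f x" t]
    unfolding set_lebesgue_integral_def tail by simp
  finally have upper: "(LINT x:{t..}|lborel. f x) = \<dots>" .
  \<comment> \<open>The full Laplace integral is cut at \<open>t\<close>: the lower part is the
    Caputo integral with time reversed, the upper part, shifted by \<open>t\<close>, is the
    defect.\<close>
  have "{0<..} = {0<..<t} \<union> {t..}" using t by auto
  then have split: "\<sigma> powr (q - 1) * Gamma (1 - q) = (LINT x:{0<..<t}|lborel. f x) + (LINT x:{t..}|lborel. f x)"
    using set_integral_Un[OF _ f1 f3] f(2) by (simp add: disjoint_iff)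
  have lower: "indicator {0<..<t} (t + -1 * x) *\<^sub>R ((t - (t + -1 * x)) powr (-q) *\<^sub>R (\<sigma> * exp (\<sigma> * (t + -1 * x)))) =
      (\<sigma> * exp (\<sigma> * t)) * (indicator {0<..<t} x *\<^sub>R f x)" for x
    by (auto simp: f_def exp_add[symmetric] algebra_simps exp_diff exp_minus divide_simps split: split_indicator)
  have "(LINT s:{0<..<t}|lborel. (t - s) powr (-q) *\<^sub>R (\<sigma> * exp (\<sigma> * s))) =
      \<sigma> * exp (\<sigma> * t) * (LINT x:{0<..<t}|lborel. f x)"
    unfolding set_lebesgue_integral_def
    by (subst lborel_integral_real_affine[of "-1" _ t], simp) (unfold lower, simp)
  also have "\<dots> = \<sigma> * exp (\<sigma> * t) * (\<sigma> powr (q - 1) * Gamma (1 - q)) -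
      \<sigma> * (LINT x:{0<..}|lborel. (t + x) powr (-q) * exp (- \<sigma> * x))"
    unfolding split upper by (simp add: algebra_simps exp_minus)
  finally have *: "(LINT s:{0<..<t}|lborel. (t - s) powr (-q) *\<^sub>R (\<sigma> * exp (\<sigma> * s))) = \<dots>" .
  have "0 < Gamma (1 - q)" using q by (intro Gamma_real_pos) auto
  moreover have "\<sigma> * \<sigma> powr (q - 1) = \<sigma> powr q" using \<sigma> powr_mult_base[of \<sigma> "q - 1"] by simp
  ultimately show "caputo_op q (\<lambda>t. \<sigma> * exp (\<sigma> * t)) t = \<sigma> powr q * exp (\<sigma> * t) -
      \<sigma> / Gamma (1 - q) * (LINT x:{0<..}|lborel. (t + x) powr (-q) * exp (- \<sigma> * x))"
    unfolding caputo_op_def *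
    by (simp add: right_diff_distrib)
qed

text \<open>The defect \<open>W t\<close> is nonnegative and decreases from
  \<open>W 0 = \<sigma> powr q\<close>, which gives the first two bounds. The third records that the
  decrease is strict: because \<open>\<rho>\<close> is smaller than \<open>\<sigma> powr q\<close>,
  the later barrier, an exponential minus a constant, is positive at 0.\<close>

lemma
  fixes q \<sigma> :: real
  assumes q: "0 < q" "q < 1" and \<sigma>: "0 < \<sigma>"
  shows caputo_op_exp_le: "0 < t \<Longrightarrow> caputo_op q (\<lambda>t. \<sigma> * exp (\<sigma> * t)) t \<le> \<sigma> powr q * exp (\<sigma> * t)"
    and caputo_op_exp_ge: "0 < t \<Longrightarrow>
      \<sigma> powr q * (exp (\<sigma> * t) - 1) \<le> caputo_op q (\<lambda>t. \<sigma> * exp (\<sigma> * t)) t"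
    and caputo_op_exp_ge_late: "0 < \<tau> \<Longrightarrow> \<exists>\<rho><\<sigma> powr q. \<forall>t\<ge>\<tau>.
      \<sigma> powr q * exp (\<sigma> * t) - \<rho> \<le> caputo_op q (\<lambda>t. \<sigma> * exp (\<sigma> * t)) t"
proof -
  have G: "Gamma (1 - q) > 0" using q by (intro Gamma_real_pos) auto
  define W where "W t = \<sigma> / Gamma (1 - q) * (LINT x:{0<..}|lborel. (t + x) powr (-q) * exp (- \<sigma> * x))" for t
  have int: "set_integrable lborel {0<..} (\<lambda>x. (t + x) powr (-q) * exp (- \<sigma> * x))" if "0 \<le> t" for t
    using caputo_op_exp_defect(1)[OF q \<sigma>, of t] Gamma_integral_Ioi(1)[of "1 - q" \<sigma>] that q \<sigma>
    by (cases "t = 0") auto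
  have mono: "W t \<le> W s" if "0 \<le> s" "s \<le> t" for s t
    unfolding W_def
    using that \<sigma> G q by (intro mult_left_mono set_integral_mono int mult_right_mono powr_mono2') auto
  have "\<sigma> * \<sigma> powr (q - 1) = \<sigma> powr q" using \<sigma> powr_mult_base[of \<sigma> "q - 1"] by simp
  then have W0: "W 0 = \<sigma> powr q"
    using Gamma_integral_Ioi(2)[of "1 - q" \<sigma>] q \<sigma> by (simp add: W_def less_imp_neq[OF G, symmetric])
  have Wpos: "0 \<le> W t" for t
    unfolding W_def set_lebesgue_integral_def using \<sigma> G
    by (intro mult_nonneg_nonneg integral_nonneg) auto
  have op: "caputo_op q (\<lambda>t. \<sigma> * exp (\<sigma> * t)) t = \<sigma> powr q * exp (\<sigma> * t) - W t" if "0 < t" for t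
    using caputo_op_exp_defect(2)[OF q \<sigma> that] by (simp add: W_def)
  show "caputo_op q (\<lambda>t. \<sigma> * exp (\<sigma> * t)) t \<le> \<sigma> powr q * exp (\<sigma> * t)" if "0 < t"
    using op[OF that] Wpos[of t] by simp
  show "\<sigma> powr q * (exp (\<sigma> * t) - 1) \<le> caputo_op q (\<lambda>t. \<sigma> * exp (\<sigma> * t)) t" if "0 < t"
    using op[OF that] mono[of 0 t] that W0 by (simp add: algebra_simps)
  have strict: "W \<tau> < W 0" if "0 < \<tau>" for \<tau>
  proof (rule ccontr)
    define D where "D x = x powr (-q) * exp (- \<sigma> * x) - (\<tau> + x) powr (-q) * exp (- \<sigma> * x)" for x
    assume "\<not> W \<tau> < W 0"
    then have "(LINT x:{0<..}|lborel. (0 + x) powr (-q) * exp (- \<sigma> * x)) =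
        (LINT x:{0<..}|lborel. (\<tau> + x) powr (-q) * exp (- \<sigma> * x))"
      using mono[of 0 \<tau>] that \<sigma> G unfolding W_def by auto
    then have "(LINT x:{0<..}|lborel. D x) = 0"
      unfolding D_def using int[of 0] int[of \<tau>] that by (subst set_integral_diff) auto
    moreover have pos: "0 < D x" if "0 < x" for x
      using that \<open>0 < \<tau>\<close> q unfolding D_def by (auto intro!: mult_strict_right_mono powr_less_mono2_neg)
    moreover have "set_integrable lborel {0<..} D"
      unfolding D_def using int[of 0] int[of \<tau>] that by (intro set_integral_diff) auto
    ultimately have "AE x in lborel. indicator {0<..} x *\<^sub>R D x = 0"
      unfolding set_integrable_def set_lebesgue_integral_def
      by (subst integral_nonneg_eq_0_iff_AE[symmetric]) (auto split: split_indicator intro: less_imp_le)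
    then have "AE x in lborel. x \<notin> {0<..(1::real)}"
      by eventually_elim (use pos in \<open>force split: split_indicator_asm\<close>)
    then have "emeasure lborel {0<..(1::real)} = 0"
      using AE_iff_measurable[of "{0<..1}" lborel "\<lambda>x. x \<notin> {0<..(1::real)}"] by fastforce
    moreover have "emeasure lborel {0<..(1::real)} = 1" by simp
    ultimately show False by (metis zero_neq_one)
  qed
  show "\<exists>\<rho><\<sigma> powr q. \<forall>t\<ge>\<tau>. \<sigma> powr q * exp (\<sigma> * t) - \<rho> \<le> caputo_op q (\<lambda>t. \<sigma> * exp (\<sigma> * t)) t"
    if "0 < \<tau>"
    using strict[OF that] W0 op mono[of \<tau>] that by (intro exI[of _ "W \<tau>"]) auto
qed

section \<open>Growth and decay bounds\<close>

lemma
  fixes u v :: "real \<Rightarrow> real"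
  assumes "caputo_path q u v T"
  shows caputo_path_scale_add: "caputo_path q (\<lambda>t. c * u t + d) (\<lambda>t. c * v t) T"
    and caputo_op_scale: "t \<in> {0<..T} \<Longrightarrow> caputo_op q (\<lambda>t. c * v t) t = c * caputo_op q v t"
  using caputo_path_diff[OF caputo_path_linear[OF bounded_linear_mult_right assms, of c] caputo_path_const[of q "-d" T]]
    caputo_op_linear[OF bounded_linear_mult_right assms, of t c]
  by auto

text \<open>
  Two barriers: \<open>m * (1 + A * t powr q)\<close> near 0, where a differentiable barrier fails because its
  Caputo derivative vanishes at 0, and then a combination of \<open>exp (\<mu> * t)\<close> and a constant.
\<close>

lemma caputo_growth_bound:
  fixes q k :: real
  assumes q: "0 < q" "q < 1" and k: "0 < k"
  obtains C where "1 \<le> C"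
    and "\<And>(u :: real \<Rightarrow> 'a::euclidean_space) v T m t. \<lbrakk>caputo_path q u v T; norm (u 0) < m;
      \<And>t. \<lbrakk>t \<in> {0<..T}; norm (u t) \<le> C * m * exp (k powr (1 / q) * T)\<rbrakk> \<Longrightarrow>
        u t \<bullet> caputo_op q v t \<le> k * (norm (u t))\<^sup>2; t \<in> {0..T}\<rbrakk> \<Longrightarrow>
      norm (u t) < C * m * exp (k powr (1 / q) * t)"
proof -
  define \<mu> where "\<mu> = k powr (1 / q)"
  have \<mu>: "0 < \<mu>" "\<mu> powr q = k" using k q by (auto simp: \<mu>_def powr_powr)
  \<comment> \<open>With this \<open>A\<close> the barrier \<open>m * (1 + A * t powr q)\<close> has
    the constant derivative \<open>2 * k * m\<close>. It stays below \<open>2 * m\<close> up to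
    \<open>\<tau>\<close>, so its derivative is at least \<open>k\<close> times its value
    there.\<close>
  define A where "A = 2 * k / Gamma (1 + q)"
  have G: "0 < Gamma (1 + q)" using q by (intro Gamma_real_pos) auto
  then have A: "0 < A" "A * Gamma (1 + q) = 2 * k" using k by (auto simp: A_def)
  define \<tau> where "\<tau> = (1 / A) powr (1 / q)"
  have \<tau>: "0 < \<tau>" "\<tau> powr q = 1 / A" using A q by (auto simp: \<tau>_def powr_powr)
  obtain \<rho>' where "\<rho>' < \<mu> powr q"
      "\<forall>t\<ge>\<tau>. \<mu> powr q * exp (\<mu> * t) - \<rho>' \<le> caputo_op q (\<lambda>t. \<mu> * exp (\<mu> * t)) t"
    using caputo_op_exp_ge_late[OF q \<mu>(1) \<tau>(1)] by blast
  then obtain \<rho> where \<rho>: "\<rho> < k" "0 \<le> \<rho>"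
      "\<And>t. \<tau> \<le> t \<Longrightarrow> k * exp (\<mu> * t) - \<rho> \<le> caputo_op q (\<lambda>t. \<mu> * exp (\<mu> * t)) t"
    using k \<mu>(2) by (atomize_elim, intro exI[of _ "max 0 \<rho>'"]) fastforce
  \<comment> \<open>\<open>C\<close> solves \<open>C - C * \<rho> / k = 2\<close>: the barrier
    \<open>m * (C * exp (\<mu> * t) - C * \<rho> / k)\<close> then starts at \<open>2 * m\<close>,
    the level that bounds the solution up to \<open>\<tau>\<close>.\<close>
  define C where "C = 2 * k / (k - \<rho>)"
  have C: "2 \<le> C" using \<rho>(1,2) k by (simp add: C_def field_simps)
  have CB: "C - C * \<rho> / k = 2"
  proof -
    have "C - C * \<rho> / k = C * (k - \<rho>) / k" using k by (simp add: field_simps)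
    then show ?thesis using k \<rho>(1) by (simp add: C_def)
  qed
  have B0: "0 \<le> C * \<rho> / k" using C \<rho>(2) k by simp
  have bound: "norm (u t) < C * m * exp (\<mu> * t)"
    if path: "caputo_path q u v T" and m: "norm (u 0) < m" and t: "t \<in> {0..T}"
      and energy: "\<And>t. \<lbrakk>t \<in> {0<..T}; norm (u t) \<le> C * m * exp (\<mu> * T)\<rbrakk> \<Longrightarrow>
        u t \<bullet> caputo_op q v t \<le> k * (norm (u t))\<^sup>2"
    for u v :: "real \<Rightarrow> 'a" and T m t
  proof -
    have m0: "0 < m" using m norm_ge_zero[of "u 0"] by linarith
    have T: "0 \<le> T" using t by simp
    have expT: "1 \<le> exp (\<mu> * T)" using \<mu>(1) T by simp
    \<comment> \<open>The energy inequality is available only on the a priori ball of radius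
      \<open>C * m * exp (\<mu> * T)\<close>, where a truncated field can agree with the original
      one. Both barriers stay inside that ball.\<close>
    have touch: "u s \<bullet> caputo_op q v s \<le> G * g"
      if "s \<in> {0<..T}" "norm (u s) = G" "0 \<le> G" "G \<le> C * m * exp (\<mu> * T)" "k * G \<le> g" for s G g
    proof -
      have "u s \<bullet> caputo_op q v s \<le> k * (norm (u s))\<^sup>2" using energy that by auto
      also have "\<dots> = G * (k * G)" using that by (simp add: power2_eq_square)
      also have "\<dots> \<le> G * g" using that by (intro mult_left_mono) auto
      finally show ?thesis .
    qed
    define S where "S = min \<tau> T"
    have "2 * m \<le> C * m * 1" using C m0 by simp
    also have "\<dots> \<le> C * m * exp (\<mu> * T)" using expT C m0 by (intro mult_left_mono) auto
    finally have Cm: "2 * m \<le> C * m * exp (\<mu> * T)" .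
    have pathS: "caputo_path q u v S" by (rule caputo_path_mono[OF path]) (simp add: S_def)
    have early: "norm (u s) < 2 * m" if s: "s \<in> {0..S}" for s
    proof -
      have le: "m * A * r powr q + m \<le> 2 * m" if "r \<in> {0..S}" for r
      proof -
        have "r powr q \<le> 1 / A" unfolding \<tau>(2)[symmetric]
          using that q by (intro powr_mono2) (auto simp: S_def)
        then have "m * (A * r powr q) \<le> m * 1"
          using A m0 by (intro mult_left_mono) (auto simp: field_simps)
        then show ?thesis by simp
      qed
      note p = caputo_path_powr[OF q, of S]
      have "norm (u s) < m * A * s powr q + m"
      proof (rule caputo_norm_comparison[OF q pathS caputo_path_scale_add[OF p], of 0])
        show "0 < m * A * t powr q + m" for t using m0 A by (intro add_nonneg_pos) auto
        fix r assume r: "r \<in> {0<..S}" "norm (u r) = m * A * r powr q + m"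
        have "caputo_op q (\<lambda>t. m * A * (q * t powr (q - 1))) r = m * (A * Gamma (1 + q))"
          using r caputo_op_scale[OF p, of r] caputo_op_powr[OF q, of r] by simp
        also have "\<dots> = k * (2 * m)" unfolding A(2) by simp
        finally have op: "caputo_op q (\<lambda>t. m * A * (q * t powr (q - 1))) r = \<dots>" .
        show "u r \<bullet> caputo_op q v r \<le> (m * A * r powr q + m) *
            caputo_op q (\<lambda>t. m * A * (q * t powr (q - 1))) r"
          unfolding op using r le[of r] k Cm norm_ge_zero[of "u r"]
          by (intro touch) (auto simp: S_def simp del: norm_ge_zero)
      qed (use m s q in auto)
      also have "\<dots> \<le> 2 * m" by (rule le[OF s])
      finally show ?thesis .
    qed
    define H where "H s = m * C * exp (\<mu> * s) + - (m * (C * \<rho> / k))" for s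
    have H2: "2 * m \<le> H s" if "0 \<le> s" for s
    proof -
      have "2 * m = m * C * 1 + - (m * (C * \<rho> / k))"
        unfolding CB[symmetric] by (simp add: algebra_simps)
      also have "\<dots> \<le> H s"
        unfolding H_def using that \<mu>(1) m0 C by (intro add_mono mult_left_mono) auto
      finally show ?thesis .
    qed
    have Hle: "H s \<le> C * m * exp (\<mu> * s)" for s
      unfolding H_def using mult_nonneg_nonneg[OF less_imp_le[OF m0] B0]
      by (simp add: mult.commute[of m C])
    note p = caputo_path_exp[OF q, of \<mu> T]
    have pathH: "caputo_path q H (\<lambda>t. m * C * (\<mu> * exp (\<mu> * t))) T"
      unfolding H_def by (rule caputo_path_scale_add[OF p])
    have "norm (u t) < H t"
    proof (rule caputo_norm_comparison[OF q path pathH, of \<tau>])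
      show "0 < H t" if "t \<in> {0..T}" for t using H2[of t] m0 that by auto
      show "norm (u t) < H t" if "t \<in> {0..T}" "t \<le> \<tau>" for t
        using early[of t] H2[of t] that by (auto simp: S_def)
      fix r assume r: "r \<in> {\<tau><..T}" "norm (u r) = H r"
      have "k * H r = m * C * (k * exp (\<mu> * r) - \<rho>)"
        using k by (simp add: H_def field_simps)
      also have "\<dots> \<le> m * C * caputo_op q (\<lambda>t. \<mu> * exp (\<mu> * t)) r"
        using r \<rho>(3) m0 C by (intro mult_left_mono) auto
      also have "\<dots> = caputo_op q (\<lambda>t. m * C * (\<mu> * exp (\<mu> * t))) r"
        using caputo_op_scale[OF p, of r] r \<tau>(1) by simp
      finally have op: "k * H r \<le> \<dots>" .
      have "H r \<le> C * m * exp (\<mu> * r)" by (rule Hle)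
      also have "\<dots> \<le> C * m * exp (\<mu> * T)"
        using r C m0 \<mu>(1) by (intro mult_left_mono) auto
      finally show "u r \<bullet> caputo_op q v r \<le> H r * caputo_op q (\<lambda>t. m * C * (\<mu> * exp (\<mu> * t))) r"
        using r \<tau>(1) op H2[of r] m0 by (intro touch) auto
    qed (use t \<tau> in auto)
    with Hle[of t] show ?thesis by linarith
  qed
  show thesis
    by (rule that[of C]) (use C bound in \<open>auto simp: \<mu>_def\<close>)
qed

section \<open>From the componentwise definition to vector-valued paths; decay\<close>

lemma set_integrable_vec_nth:
  fixes f :: "real \<Rightarrow> real ^ 'n"
  assumes "\<And>i. set_integrable M A (\<lambda>x. f x $ i)"
  shows "set_integrable M A f"
proof -
  have "f = (\<lambda>x. \<Sum>i\<in>UNIV. f x $ i *\<^sub>R axis i 1)"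
    by (simp add: fun_eq_iff vec_eq_iff axis_def if_distrib cong: if_cong)
  moreover have "set_integrable M A (\<lambda>x. \<Sum>i\<in>UNIV. f x $ i *\<^sub>R axis i (1::real))"
    using assms by (auto simp: set_integrable_def scaleR_sum_right intro!: integrable_sum integrable_scaleR_left)
  ultimately show ?thesis by simp
qed

text \<open>The component equations become one vector equation, which can be tested against
  arbitrary directions and not only the coordinate axes.\<close>

lemma caputo_solution_iff:
  fixes x :: "real \<Rightarrow> real ^ 'n"
  shows "caputo_solution q f x \<longleftrightarrow>
    (\<exists>v. (\<forall>T. caputo_path q x v T) \<and> (\<forall>t>0. caputo_op q v t = f (x t)))" (is "?L \<longleftrightarrow> ?R")
proof -
  have deriv: "deriv (\<lambda>s. x s $ i) s = v s $ i" if "(x has_vector_derivative v s) (at s)" for s v i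
    using bounded_linear.has_vector_derivative[OF bounded_linear_vec_nth that, of i]
    by (auto simp: has_real_derivative_iff_has_vector_derivative[symmetric] intro: DERIV_imp_deriv)
  have diff_iff: "caputo_differentiable q (\<lambda>s. x s $ i) t \<longleftrightarrow>
      set_integrable lborel {0<..<t} (\<lambda>s. (t - s) powr (-q) * v s $ i)"
    if "\<And>s. 0 < s \<Longrightarrow> (x has_vector_derivative v s) (at s)" for t v i
    unfolding caputo_differentiable_def using deriv that by (intro set_integrable_cong) auto
  have op: "caputo_deriv q (\<lambda>s. x s $ i) t = caputo_op q v t $ i"
    if "caputo_path q x v t" "\<And>s. 0 < s \<Longrightarrow> (x has_vector_derivative v s) (at s)" "0 < t" for t v i
  proof -
    have "caputo_deriv q (\<lambda>s. x s $ i) t = caputo_op q (\<lambda>s. v s $ i) t"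
      unfolding caputo_deriv_def caputo_op_def using deriv that(2)
      by (auto intro!: arg_cong[where f="\<lambda>z. 1 / Gamma (1 - q) * z"] set_lebesgue_integral_cong)
    also have "\<dots> = caputo_op q v t $ i"
      using caputo_op_linear[OF bounded_linear_vec_nth that(1)] that(3) by auto
    finally show ?thesis .
  qed
  show ?thesis
  proof
    assume L: ?L
    define v where "v t = vector_derivative x (at t)" for t
    have v: "(x has_vector_derivative v t) (at t)" if "0 < t" for t
      using L that by (auto simp: caputo_solution_def v_def vector_derivative_works)
    have "set_integrable lborel {0<..<t} (\<lambda>s. (t - s) powr (-q) *\<^sub>R v s)" if "0 < t" for t
      using L that diff_iff[of v, OF v] by (intro set_integrable_vec_nth) (auto simp: caputo_solution_def)
    then have path: "caputo_path q x v T" for T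
      using L v by (auto simp: caputo_path_def caputo_solution_def intro: continuous_on_subset)
    then show ?R
      using L op[of v, OF _ v] by (intro exI[of _ v]) (auto simp: caputo_solution_def vec_eq_iff)
  next
    assume ?R
    then obtain v where path: "\<And>T. caputo_path q x v T" and eq: "\<And>t. 0 < t \<Longrightarrow> caputo_op q v t = f (x t)"
      by blast
    have v: "(x has_vector_derivative v t) (at t)" if "0 < t" for t
      using path[of t] that by (auto simp: caputo_path_def)
    have "continuous_on {0..} x"
      unfolding continuous_on_eq_continuous_within
    proof
      fix t :: real assume "t \<in> {0..}"
      moreover have "continuous (at t within {0..t + 1}) x"
        using path[of "t + 1"] \<open>t \<in> {0..}\<close> by (auto simp: caputo_path_def continuous_on_eq_continuous_within)
      moreover have "at t within {0..t + 1} = at t within {0..}"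
        by (rule at_within_nhd[of t "{..<t + 1}"]) auto
      ultimately show "continuous (at t within {0..}) x" by simp
    qed
    moreover have "caputo_differentiable q (\<lambda>s. x s $ i) t" if "0 < t" for t i
    proof -
      have "set_integrable lborel {0<..<t} (\<lambda>s. (t - s) powr (-q) *\<^sub>R v s $ i)"
        using caputo_path_linear[OF bounded_linear_vec_nth path[of t], of i] that by (auto simp: caputo_path_def)
      then show ?thesis using diff_iff[of v, OF v] by simp
    qed
    ultimately show ?L
      unfolding caputo_solution_def using v op[OF path v] eq
      by (auto simp: vector_derivative_works[symmetric] intro: differentiableI_vector)
  qed
qed

text \<open>
  The barrier \<open>\<kappa> / (1 + a * t) + \<eta> / 2\<close> is a supersolution of \<open>D\<^sup>q G = k * G\<close> when \<open>a\<close> is small,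
  and its limit \<open>\<eta> / 2\<close> is arbitrarily small.
\<close>

lemma
  fixes u v :: "real \<Rightarrow> 'a::euclidean_space"
  assumes q: "0 < q" "q < 1" and k: "k < 0" and path: "\<And>T. caputo_path q u v T"
    and energy: "\<And>t. 0 < t \<Longrightarrow> u t \<bullet> caputo_op q v t = k * (norm (u t))\<^sup>2"
  shows caputo_dissipative_bound: "norm (u 0) < \<kappa> \<Longrightarrow> 0 \<le> t \<Longrightarrow> norm (u t) < \<kappa>"
    and caputo_dissipative_tendsto_0: "((\<lambda>t. norm (u t)) \<longlongrightarrow> 0) at_top"
proof -
  have compare: "norm (u t) < G t"
    if G: "caputo_path q G g t" "norm (u 0) < G 0" "0 \<le> t" "\<And>s. 0 \<le> s \<Longrightarrow> 0 < G s"
      "\<And>s. 0 < s \<Longrightarrow> k * G s \<le> caputo_op q g s" for G g t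
  proof (rule caputo_norm_comparison[OF q path G(1), of 0])
    fix s assume s: "s \<in> {0<..t}" "norm (u s) = G s"
    then have "u s \<bullet> caputo_op q v s = G s * (k * G s)" using energy[of s] by (simp add: power2_eq_square)
    also have "\<dots> \<le> G s * caputo_op q g s" using G(4,5)[of s] s by (intro mult_left_mono) auto
    finally show "u s \<bullet> caputo_op q v s \<le> G s * caputo_op q g s" .
  qed (use G in auto)
  show const: "norm (u t) < \<kappa>" if "norm (u 0) < \<kappa>" "0 \<le> t" for \<kappa> t
  proof (rule compare[of "\<lambda>_. \<kappa>"])
    have "0 < \<kappa>" using that norm_ge_zero[of "u 0"] by linarith
    then show "0 < \<kappa>" "k * \<kappa> \<le> caputo_op q (\<lambda>_. 0) s" for s
      using k by (auto simp: caputo_op_const intro: mult_nonpos_nonneg)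
  qed (use that caputo_path_const in auto)
  show "((\<lambda>t. norm (u t)) \<longlongrightarrow> 0) at_top"
  proof (rule order_tendstoI)
    fix \<eta> :: real assume "0 < \<eta>"
    define \<kappa> where "\<kappa> = norm (u 0) + \<eta>"
    \<comment> \<open>The derivative of the decaying part is at worst
      \<open>- \<kappa> * a powr q * Gamma q\<close>. Taking \<open>c\<close> for
      \<open>a powr q\<close> keeps this above \<open>k * (\<eta> / 2)\<close>, the contribution of
      the constant part.\<close>
    define c where "c = - k * (\<eta> / 2) / ((\<kappa> + 1) * Gamma q)"
    define a where "a = c powr (1 / q)"
    have \<kappa>: "norm (u 0) < \<kappa>" "0 < \<kappa>" using \<open>0 < \<eta>\<close> by (auto simp: \<kappa>_def intro: add_nonneg_pos)
    have Gq: "0 < Gamma q" using q by (intro Gamma_real_pos) auto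
    have "0 < c"
      unfolding c_def using k \<kappa> Gq \<open>0 < \<eta>\<close> by (intro divide_pos_pos mult_pos_pos) auto
    then have a: "0 < a" "a powr q = c"
      using q by (auto simp: a_def powr_powr)
    have bound: "norm (u t) < \<kappa> * inverse (1 + a * t) + \<eta> / 2" if "0 \<le> t" for t
    proof -
      show ?thesis
      proof (rule compare[OF caputo_path_scale_add[OF caputo_path_decay[OF q a(1)]]])
        show "0 < \<kappa> * inverse (1 + a * s) + \<eta> / 2" if "0 \<le> s" for s
          using a \<kappa> \<open>0 < \<eta>\<close> that by (intro add_nonneg_pos) auto
        show "k * (\<kappa> * inverse (1 + a * s) + \<eta> / 2) \<le>
            caputo_op q (\<lambda>t. \<kappa> * (- a / (1 + a * t)\<^sup>2)) s" if s: "0 < s" for s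
        proof -
          have "k * (\<kappa> * inverse (1 + a * s)) \<le> 0"
            using k \<kappa> a s by (intro mult_nonpos_nonneg) auto
          moreover have "k * (\<eta> / 2) \<le> \<kappa> * - (a powr q * Gamma q)"
          proof -
            have "\<kappa> * (a powr q * Gamma q) = - k * (\<eta> / 2) * (\<kappa> / (\<kappa> + 1))"
              unfolding a(2) c_def using Gq by simp
            also have "\<dots> \<le> - k * (\<eta> / 2) * 1"
              using k \<kappa> \<open>0 < \<eta>\<close> by (intro mult_left_mono) (auto simp: mult_le_0_iff)
            finally show ?thesis by simp
          qed
          moreover have "\<kappa> * - (a powr q * Gamma q) \<le> \<kappa> * caputo_op q (\<lambda>t. - a / (1 + a * t)\<^sup>2) s"
            using \<kappa> s by (intro mult_left_mono caputo_op_decay[OF q a(1)]) auto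
          ultimately show ?thesis using caputo_op_scale[OF caputo_path_decay[OF q a(1)], of s s \<kappa>] s
            by (simp add: distrib_left)
        qed
      qed (use \<kappa> that \<open>0 < \<eta>\<close> in auto)
    qed
    have "filterlim (\<lambda>t. 1 + a * t) at_top at_top"
      using a(1) by (intro filterlim_tendsto_add_at_top[OF tendsto_const]
          filterlim_tendsto_pos_mult_at_top[OF tendsto_const]) (auto simp: filterlim_ident)
    then have "((\<lambda>t. \<kappa> * inverse (1 + a * t) + \<eta> / 2) \<longlongrightarrow> \<kappa> * 0 + \<eta> / 2) at_top"
      by (intro tendsto_intros tendsto_inverse_0_at_top)
    then have "eventually (\<lambda>t. \<kappa> * inverse (1 + a * t) + \<eta> / 2 < \<eta>) at_top"
      using \<open>0 < \<eta>\<close> order_tendstoD(2)[of _ "\<kappa> * 0 + \<eta> / 2" at_top \<eta>] by simp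
    with eventually_ge_at_top[of 0] show "eventually (\<lambda>t. norm (u t) < \<eta>) at_top"
      by eventually_elim (use bound in force)
  qed (auto intro!: always_eventually intro: less_le_trans)
qed

section \<open>Initial value problems for globally Lipschitz fields\<close>

text \<open>Fubini over the triangle \<open>0 < r < s < t\<close>: the inner integral over
  \<open>s\<close> is a Beta integral that does not depend on \<open>r\<close>. Up to Gamma factors,
  fractional integrals of orders \<open>q\<close> and \<open>1 - q\<close> compose to the ordinary
  integral.\<close>

lemma
  fixes g :: "real \<Rightarrow> 'a::euclidean_space"
  assumes q: "0 < q" "q < 1" and t: "0 < t" and g: "set_integrable lborel {0<..<t} g"
  shows set_integrable_fractional_semigroup: "set_integrable lborel {0<..<t}
      (\<lambda>s. (t - s) powr (-q) *\<^sub>R (LINT r:{0<..<s}|lborel. (s - r) powr (q - 1) *\<^sub>R g r))"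
    and set_integral_fractional_semigroup: "(LINT s:{0<..<t}|lborel.
      (t - s) powr (-q) *\<^sub>R (LINT r:{0<..<s}|lborel. (s - r) powr (q - 1) *\<^sub>R g r)) =
      (Gamma q * Gamma (1 - q)) *\<^sub>R (LINT r:{0<..<t}|lborel. g r)"
proof -
  define g' where "g' r = indicator {0<..<t} r *\<^sub>R g r" for r
  have int_g': "integrable lborel g'" using g by (simp add: g'_def[abs_def] set_integrable_def)
  then have [measurable]: "g' \<in> borel_measurable borel" by (simp add: borel_measurable_integrable)
  define K where "K r s = (if r < s \<and> s < t then (t - s) powr (-q) * (s - r) powr (q - 1) else 0)" for r s
  have [measurable]: "case_prod K \<in> borel_measurable (borel \<Otimes>\<^sub>M borel)"
    unfolding K_def by measurable
  have K0: "0 \<le> K r s" for r s by (simp add: K_def)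
  have K: "integrable lborel (K r)" "(LINT s|lborel. K r s) = Gamma q * Gamma (1 - q)" if "r < t" for r
  proof -
    have eq: "K r = (\<lambda>s. indicator {r<..<t} s *\<^sub>R ((t - s) powr (1 - q - 1) * (s - r) powr (q - 1)))"
      by (auto simp: K_def fun_eq_iff)
    show "integrable lborel (K r)" unfolding eq
      using set_integrable_Beta_Ioo[of q "1 - q" r t] q that by (simp add: set_integrable_def)
    show "(LINT s|lborel. K r s) = Gamma q * Gamma (1 - q)" unfolding eq
      using set_integral_Beta_Ioo[of q "1 - q" r t] q that
      by (simp add: set_lebesgue_integral_def Beta_one_minus)
  qed
  have norm_eq: "(LINT s|lborel. norm (K r s *\<^sub>R g' r)) = Gamma q * Gamma (1 - q) * norm (g' r)" for r
    using K(2)[of r] K0 by (cases "r < t") (auto simp: g'_def)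
  have int2: "integrable (lborel \<Otimes>\<^sub>M lborel) (\<lambda>(r, s). K r s *\<^sub>R g' r)"
  proof (rule lborel_pair.Fubini_integrable)
    show "(\<lambda>(r, s). K r s *\<^sub>R g' r) \<in> borel_measurable (lborel \<Otimes>\<^sub>M lborel)" by measurable
    show "integrable lborel (\<lambda>r. LINT s|lborel. norm (case (r, s) of (r, s) \<Rightarrow> K r s *\<^sub>R g' r))"
      unfolding prod.case norm_eq using int_g' by (intro integrable_mult_right integrable_norm) auto
    show "AE r in lborel. integrable lborel (\<lambda>s. case (r, s) of (r, s) \<Rightarrow> K r s *\<^sub>R g' r)"
    proof (rule AE_I2)
      fix r show "integrable lborel (\<lambda>s. case (r, s) of (r, s) \<Rightarrow> K r s *\<^sub>R g' r)"
        using K(1)[of r] by (cases "r < t") (auto simp: g'_def intro: integrable_scaleR_left)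
    qed
  qed
  have inner: "(LINT r|lborel. K r s *\<^sub>R g' r) = indicator {0<..<t} s *\<^sub>R
      ((t - s) powr (-q) *\<^sub>R (LINT r:{0<..<s}|lborel. (s - r) powr (q - 1) *\<^sub>R g r))" for s
  proof (cases "s \<in> {0<..<t}")
    case True
    then have "K r s *\<^sub>R g' r = (t - s) powr (-q) *\<^sub>R (indicator {0<..<s} r *\<^sub>R ((s - r) powr (q - 1) *\<^sub>R g r))" for r
      by (auto simp: K_def g'_def split: split_indicator)
    then have "(LINT r|lborel. K r s *\<^sub>R g' r) =
        (LINT r|lborel. (t - s) powr (-q) *\<^sub>R (indicator {0<..<s} r *\<^sub>R ((s - r) powr (q - 1) *\<^sub>R g r)))"
      by (simp only:)
    also have "\<dots> = (t - s) powr (-q) *\<^sub>R (LINT r:{0<..<s}|lborel. (s - r) powr (q - 1) *\<^sub>R g r)"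
      unfolding set_lebesgue_integral_def by (rule integral_scaleR_right)
    finally show ?thesis using True by simp
  next
    case False
    then have "(\<lambda>r. K r s *\<^sub>R g' r) = (\<lambda>_. 0)"
      by (auto simp: K_def g'_def fun_eq_iff split: split_indicator)
    then show ?thesis using False by (simp only:) simp
  qed
  show "set_integrable lborel {0<..<t}
      (\<lambda>s. (t - s) powr (-q) *\<^sub>R (LINT r:{0<..<s}|lborel. (s - r) powr (q - 1) *\<^sub>R g r))"
    using lborel_pair.integrable_snd[OF int2] unfolding set_integrable_def inner by simp
  have outer: "(LINT s|lborel. K r s *\<^sub>R g' r) = (Gamma q * Gamma (1 - q)) *\<^sub>R g' r" for r
    using K[of r] by (cases "r < t") (auto simp: g'_def)
  have "(LINT s|lborel. LINT r|lborel. K r s *\<^sub>R g' r) = (LINT r|lborel. LINT s|lborel. K r s *\<^sub>R g' r)"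
    using lborel_pair.Fubini_integral[of "\<lambda>r s. K r s *\<^sub>R g' r"] int2 by simp
  then show "(LINT s:{0<..<t}|lborel.
      (t - s) powr (-q) *\<^sub>R (LINT r:{0<..<s}|lborel. (s - r) powr (q - 1) *\<^sub>R g r)) =
      (Gamma q * Gamma (1 - q)) *\<^sub>R (LINT r:{0<..<t}|lborel. g r)"
    unfolding inner outer integral_scaleR_right by (simp add: set_lebesgue_integral_def g'_def)
qed

text \<open>After the substitution \<open>s = t * x\<close> the domain no longer depends on
  \<open>t\<close>, so continuity up to \<open>t = 0\<close> is dominated convergence, with a bound
  of \<open>h\<close> times \<open>\<kappa>\<close> as majorant.\<close>

lemma
  fixes h :: "real \<Rightarrow> 'a::euclidean_space" and \<kappa> :: "real \<Rightarrow> real"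
  assumes \<kappa>: "set_integrable lborel {0<..<1} \<kappa>" and h: "continuous_on {0..T} h"
  shows set_integrable_dilation: "t \<in> {0..T} \<Longrightarrow>
      set_integrable lborel {0<..<1} (\<lambda>x. \<kappa> x *\<^sub>R h (t * x))"
    and continuous_on_dilation: "continuous_on {0..T} (\<lambda>t. LINT x:{0<..<1}|lborel. \<kappa> x *\<^sub>R h (t * x))"
proof -
  obtain B where B: "\<And>s. s \<in> {0..T} \<Longrightarrow> norm (h s) \<le> B"
    using compact_imp_bounded[OF compact_continuous_image[OF h]] by (force simp: bounded_iff)
  have mem: "t * x \<in> {0..T}" if "t \<in> {0..T}" "x \<in> {0<..<1}" for t x
    using that mult_left_mono[of x 1 t] by auto
  define \<kappa>' where "\<kappa>' x = indicator {0<..<1} x *\<^sub>R \<kappa> x" for x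
  have \<kappa>': "integrable lborel \<kappa>'" using \<kappa> by (simp add: \<kappa>'_def[abs_def] set_integrable_def)
  then have [measurable]: "\<kappa>' \<in> borel_measurable borel" by (simp add: borel_measurable_integrable)
  define f where "f t x = \<kappa>' x *\<^sub>R (indicator {0<..<1} x *\<^sub>R h (t * x))" for t x
  have f_eq: "f t x = indicator {0<..<1} x *\<^sub>R (\<kappa> x *\<^sub>R h (t * x))" for t x
    by (simp add: f_def \<kappa>'_def split: split_indicator)
  have meas[measurable]: "f t \<in> borel_measurable lborel" if "t \<in> {0..T}" for t
  proof -
    have "continuous_on {0<..<1} (\<lambda>x. h (t * x))"
      by (rule continuous_on_compose2[OF h]) (use mem[OF that] in \<open>auto intro!: continuous_intros\<close>)
    then have "(\<lambda>x. indicator {0<..<1} x *\<^sub>R h (t * x)) \<in> borel_measurable borel"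
      by (intro borel_measurable_continuous_on_indicator) auto
    then show ?thesis unfolding f_def by measurable
  qed
  have bound: "norm (f t x) \<le> norm (\<kappa>' x * B)" if "t \<in> {0..T}" for t x
    using B[OF mem[OF that]] by (auto simp: f_def abs_mult intro!: mult_left_mono split: split_indicator
      intro: order.trans[OF _ abs_ge_self])
  have int: "integrable lborel (f t)" if "t \<in> {0..T}" for t
    by (rule Bochner_Integration.integrable_bound[OF integrable_mult_left[OF \<kappa>', of B]])
      (use bound meas that in auto)
  then show "set_integrable lborel {0<..<1} (\<lambda>x. \<kappa> x *\<^sub>R h (t * x))" if "t \<in> {0..T}"
    using that by (simp add: set_integrable_def f_eq[abs_def])
  have "continuous_on {0..T} (\<lambda>t. LINT x|lborel. f t x)"
    unfolding continuous_on_sequentially comp_def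
  proof safe
    fix X a assume X: "\<forall>n. X n \<in> {0..T}" "a \<in> {0..T}" "X \<longlonglongrightarrow> a"
    show "(\<lambda>n. LINT x|lborel. f (X n) x) \<longlonglongrightarrow> (LINT x|lborel. f a x)"
    proof (rule integral_dominated_convergence[where w = "\<lambda>x. norm (\<kappa>' x * B)"])
      show "AE x in lborel. (\<lambda>n. f (X n) x) \<longlonglongrightarrow> f a x"
      proof (rule AE_I2)
        fix x show "(\<lambda>n. f (X n) x) \<longlonglongrightarrow> f a x"
        proof (cases "x \<in> {0<..<1}")
          case True
          have "(\<lambda>n. h (X n * x)) \<longlonglongrightarrow> h (a * x)"
            by (rule continuous_on_tendsto_compose[OF h])
              (use X mem[OF _ True] in \<open>auto intro!: tendsto_intros always_eventually simp del: atLeastAtMost_iff\<close>)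
          then show ?thesis unfolding f_def by (intro tendsto_intros)
        qed (simp add: f_def)
      qed
    qed (use X bound meas \<kappa>' in \<open>auto intro!: integrable_norm integrable_mult_left\<close>)
  qed
  then show "continuous_on {0..T} (\<lambda>t. LINT x:{0<..<1}|lborel. \<kappa> x *\<^sub>R h (t * x))"
    by (simp add: set_lebesgue_integral_def f_eq)
qed

text \<open>The Lipschitz condition is placed on \<open>F'\<close> because the fixed point equation
  is the differentiated one and contains \<open>F'\<close> itself.\<close>

locale smooth_caputo_ivp =
  fixes q T L M :: real and F :: "'a::euclidean_space \<Rightarrow> 'a" and F' :: "'a \<Rightarrow> 'a \<Rightarrow>\<^sub>L 'a" and u0 :: 'a
  assumes q: "0 < q" "q < 1" and T: "0 < T"
    and F': "\<And>u. (F has_derivative blinfun_apply (F' u)) (at u)"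
    and bounded: "\<And>u. norm (F' u) \<le> L"
    and lipschitz: "\<And>u w. norm (F' u - F' w) \<le> M * norm (u - w)"
begin

text \<open>The first factor is the singularity of the derivative of the solution at 0, the second
  the Volterra kernel.\<close>

definition \<beta> :: "real \<Rightarrow> real" where "\<beta> x = x powr (q - 1) * (1 - x) powr (q - 1)"

text \<open>The primitive of \<open>s powr (q - 1) *\<^sub>R w s\<close> with value
  \<open>u0\<close> at 0, after the substitution \<open>s = t * x\<close>.\<close>

definition U :: "(real \<Rightarrow> 'a) \<Rightarrow> real \<Rightarrow> 'a" where
  "U w t = u0 + t powr q *\<^sub>R (LINT x:{0<..<1}|lborel. x powr (q - 1) *\<^sub>R w (t * x))"

text \<open>
  With \<open>u' t = t powr (q - 1) * w t\<close>, the equation \<open>D\<^sup>q u = F u\<close> becomes \<open>w = W w\<close>: it is the derivative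
  of the Volterra equation \<open>u = u0 + I\<^sup>q (F u)\<close> after the substitution \<open>s = t * x\<close>.
\<close>

definition W :: "(real \<Rightarrow> 'a) \<Rightarrow> real \<Rightarrow> 'a" where
  "W w t = (1 / Gamma q) *\<^sub>R (F u0 + t powr q *\<^sub>R
     (LINT x:{0<..<1}|lborel. \<beta> x *\<^sub>R blinfun_apply (F' (U w (t * x))) (w (t * x))))"

lemma L_nonneg: "0 \<le> L" using bounded norm_ge_zero order_trans by blast

lemma M_nonneg: "0 \<le> M"
proof -
  obtain b :: 'a where "b \<in> Basis" using nonempty_Basis by blast
  then show ?thesis using order.trans[OF norm_ge_zero lipschitz[of b 0]] by simp
qed

lemma Gamma_q: "0 < Gamma q" using q by (intro Gamma_real_pos) auto

lemma set_integrable_\<beta>: "set_integrable lborel {0<..<1} \<beta>"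
  unfolding \<beta>_def[abs_def] by (rule set_integrable_Beta01) (use q in auto)

lemma set_integrable_powr01: "set_integrable lborel {0<..<1} (\<lambda>x. x powr (q - 1))"
  using set_integrable_Beta01[of q 1] q by (auto elim!: set_integrable_cong[THEN iffD1, rotated -1])

lemma set_integral_powr01: "(LINT x:{0<..<1}|lborel. x powr (q - 1)) = Beta q 1"
proof -
  have "(LINT x:{0<..<1}|lborel. x powr (q - 1)) = (LINT x:{0<..<1}|lborel. x powr (q - 1) * (1 - x) powr (1 - 1))"
    by (intro set_lebesgue_integral_cong) auto
  then show ?thesis using set_integral_Beta01[of q 1] q by simp
qed

lemma continuous_on_powr_q: "continuous_on {0..T} (\<lambda>t. t powr q)"
  using q by (intro continuous_on_powr' continuous_intros) auto

lemma continuous_on_U: "continuous_on {0..T} w \<Longrightarrow> continuous_on {0..T} (U w)"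
  unfolding U_def[abs_def]
  by (intro continuous_intros continuous_on_powr_q continuous_on_dilation set_integrable_powr01)

lemma continuous_on_F': "continuous_on S F'"
proof (rule lipschitz_on_continuous_on[of M])
  show "M-lipschitz_on S F'" using lipschitz M_nonneg by (intro lipschitz_onI) (auto simp: dist_norm)
qed

lemma continuous_on_F'U:
  assumes "continuous_on {0..T} w"
  shows "continuous_on {0..T} (\<lambda>s. blinfun_apply (F' (U w s)) (w s))"
  by (intro continuous_intros assms continuous_on_compose2[OF continuous_on_F' continuous_on_U[OF assms], of UNIV]) auto

lemma continuous_on_W: "continuous_on {0..T} w \<Longrightarrow> continuous_on {0..T} (W w)"
  unfolding W_def[abs_def]
  by (intro continuous_intros continuous_on_powr_q
      continuous_on_dilation[OF set_integrable_\<beta> continuous_on_F'U])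

text \<open>
  From \<open>exp (- y) \<le> y powr (- q / 2)\<close> with \<open>y = \<omega> * t * (1 - x)\<close>: in the norm weighted by
  \<open>exp (\<omega> * t)\<close> the integral operator is as small as desired when \<open>\<omega>\<close> is large.
\<close>

lemma \<beta>_dilation_bound:
  fixes h :: "real \<Rightarrow> 'a"
  assumes h: "continuous_on {0..T} h" and \<omega>: "0 < \<omega>" and t: "t \<in> {0..T}"
    and D: "\<And>s. s \<in> {0..T} \<Longrightarrow> norm (h s) \<le> D * exp (\<omega> * s)"
  shows "norm (t powr q *\<^sub>R (LINT x:{0<..<1}|lborel. \<beta> x *\<^sub>R h (t * x))) \<le>
    T powr (q / 2) * Beta q (q / 2) * \<omega> powr (- q / 2) * (D * exp (\<omega> * t))"
proof (cases "t = 0")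
  case True
  then show ?thesis using D[of 0] T q
    by (auto intro!: mult_nonneg_nonneg simp: Beta_def Gamma_real_pos less_imp_le order.trans[OF norm_ge_zero])
next
  case False
  with t have t0: "0 < t" by simp
  define E where "E = D * exp (\<omega> * t)"
  have D0: "0 \<le> D" using order.trans[OF norm_ge_zero D[of 0]] T by simp
  have mem: "t * x \<in> {0..T}" if "x \<in> {0<..<1}" for x
    using that t mult_left_mono[of x 1 t] by auto
  have "norm (LINT x:{0<..<1}|lborel. \<beta> x *\<^sub>R h (t * x)) \<le> (LINT x:{0<..<1}|lborel. norm (\<beta> x *\<^sub>R h (t * x)))"
    using set_integral_norm_bound[OF set_integrable_dilation[OF set_integrable_\<beta> h t]] .
  also have "\<dots> \<le> (LINT x:{0<..<1}|lborel. E * (\<omega> * t) powr (- q / 2) * (x powr (q - 1) * (1 - x) powr (q / 2 - 1)))"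
  proof (rule set_integral_mono)
    show "set_integrable lborel {0<..<1} (\<lambda>x. norm (\<beta> x *\<^sub>R h (t * x)))"
      by (rule set_integrable_norm[OF set_integrable_dilation[OF set_integrable_\<beta> h t]])
    show "set_integrable lborel {0<..<1} (\<lambda>x. E * (\<omega> * t) powr (- q / 2) * (x powr (q - 1) * (1 - x) powr (q / 2 - 1)))"
      using q by (intro set_integrable_mult_right set_integrable_Beta01) auto
    fix x :: real assume x: "x \<in> {0<..<1}"
    define y where "y = \<omega> * t * (1 - x)"
    have y: "0 < y" using \<omega> t0 x by (simp add: y_def)
    have "y powr (q / 2) \<le> exp y"
    proof (cases "y \<le> 1")
      case True
      then have "y powr (q / 2) \<le> 1" using y q by (intro powr_le1) auto
      then show ?thesis using y by (simp add: order.trans)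
    next
      case False
      then have "y powr (q / 2) \<le> y powr 1" using q by (intro powr_mono) auto
      then have "y powr (q / 2) \<le> y" using y by simp
      then show ?thesis using exp_ge_add_one_self[of y] by linarith
    qed
    \<comment> \<open>The exponent \<open>q / 2\<close> is a compromise: it gains a negative power
      of \<open>\<omega>\<close> and still leaves the integrable singularity
      \<open>(1 - x) powr (q / 2 - 1)\<close>.\<close>
    then have "exp (- y) \<le> y powr (- q / 2)"
      using y by (simp add: exp_minus powr_minus le_imp_inverse_le)
    moreover have "y powr (- q / 2) = (\<omega> * t) powr (- q / 2) * (1 - x) powr (- q / 2)"
      unfolding y_def by (rule powr_mult)
    moreover have "exp (\<omega> * t) * exp (- y) = exp (\<omega> * (t * x))"
      by (simp add: y_def exp_add[symmetric] algebra_simps)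
    ultimately have "exp (\<omega> * (t * x)) \<le> exp (\<omega> * t) * ((\<omega> * t) powr (- q / 2) * (1 - x) powr (- q / 2))"
      using mult_left_mono[of "exp (- y)" "y powr (- q / 2)" "exp (\<omega> * t)"] by simp
    then have "norm (h (t * x)) \<le> E * ((\<omega> * t) powr (- q / 2) * (1 - x) powr (- q / 2))"
      using order.trans[OF D[OF mem[OF x]] mult_left_mono[OF _ D0]] by (simp add: E_def mult.assoc)
    then have "\<beta> x * norm (h (t * x)) \<le> \<beta> x * (E * ((\<omega> * t) powr (- q / 2) * (1 - x) powr (- q / 2)))"
      by (intro mult_left_mono) (auto simp: \<beta>_def)
    also have "\<dots> = E * (\<omega> * t) powr (- q / 2) * (x powr (q - 1) * ((1 - x) powr (q - 1) * (1 - x) powr (- q / 2)))"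
      by (simp add: \<beta>_def mult_ac)
    also have "(1 - x) powr (q - 1) * (1 - x) powr (- q / 2) = (1 - x) powr (q / 2 - 1)"
      by (simp add: powr_add[symmetric])
    finally show "norm (\<beta> x *\<^sub>R h (t * x)) \<le>
        E * (\<omega> * t) powr (- q / 2) * (x powr (q - 1) * (1 - x) powr (q / 2 - 1))"
      by (simp add: \<beta>_def)
  qed
  also have "\<dots> = E * (\<omega> * t) powr (- q / 2) * Beta q (q / 2)"
    using q by (subst set_integral_mult_right) (simp add: set_integral_Beta01)
  finally have "norm (t powr q *\<^sub>R (LINT x:{0<..<1}|lborel. \<beta> x *\<^sub>R h (t * x))) \<le>
      t powr q * (E * (\<omega> * t) powr (- q / 2) * Beta q (q / 2))"
    by (simp add: mult_left_mono)
  also have "\<dots> = E * \<omega> powr (- q / 2) * Beta q (q / 2) * t powr (q / 2)"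
  proof -
    have "t powr q * t powr (- q / 2) = t powr (q / 2)" by (simp add: powr_add[symmetric])
    then show ?thesis using \<omega> t0 by (simp add: powr_mult mult_ac)
  qed
  also have "\<dots> \<le> E * \<omega> powr (- q / 2) * Beta q (q / 2) * T powr (q / 2)"
    using q t t0 D0 unfolding E_def
    by (intro mult_left_mono powr_mono2 mult_nonneg_nonneg) (auto simp: Beta_def Gamma_real_pos less_imp_le)
  finally show ?thesis by (simp add: E_def mult_ac)
qed

text \<open>Monotonicity of the weight suffices, since no smallness is sought: the bound only feeds
  the Lipschitz constant of the integrand of \<open>W\<close> on a ball.\<close>

lemma U_diff_bound:
  assumes w: "continuous_on {0..T} w1" "continuous_on {0..T} w2" and \<omega>: "0 < \<omega>" and t: "t \<in> {0..T}"
    and D: "\<And>s. s \<in> {0..T} \<Longrightarrow> norm (w1 s - w2 s) \<le> D * exp (\<omega> * s)"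
  shows "norm (U w1 t - U w2 t) \<le> T powr q * Beta q 1 * (D * exp (\<omega> * t))"
proof -
  have D0: "0 \<le> D" using order.trans[OF norm_ge_zero D[of 0]] T by simp
  have mem: "t * x \<in> {0..T}" if "x \<in> {0<..<1}" for x
    using that t mult_left_mono[of x 1 t] by auto
  have w12: "continuous_on {0..T} (\<lambda>s. w1 s - w2 s)" by (intro continuous_intros w)
  note int = set_integrable_dilation[OF set_integrable_powr01 w12 t]
  have "U w1 t - U w2 t = t powr q *\<^sub>R (LINT x:{0<..<1}|lborel. x powr (q - 1) *\<^sub>R (w1 (t * x) - w2 (t * x)))"
    using set_integral_diff(2)[OF set_integrable_dilation[OF set_integrable_powr01 w(1) t]
        set_integrable_dilation[OF set_integrable_powr01 w(2) t]]
    by (simp add: U_def scaleR_diff_right)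
  then have "norm (U w1 t - U w2 t) = t powr q *
      norm (LINT x:{0<..<1}|lborel. x powr (q - 1) *\<^sub>R (w1 (t * x) - w2 (t * x)))"
    by simp
  also have "norm (LINT x:{0<..<1}|lborel. x powr (q - 1) *\<^sub>R (w1 (t * x) - w2 (t * x))) \<le>
      D * exp (\<omega> * t) * Beta q 1"
  proof -
    have "norm (LINT x:{0<..<1}|lborel. x powr (q - 1) *\<^sub>R (w1 (t * x) - w2 (t * x))) \<le>
      (LINT x:{0<..<1}|lborel. norm (x powr (q - 1) *\<^sub>R (w1 (t * x) - w2 (t * x))))"
    by (rule set_integral_norm_bound[OF int])
    also have "\<dots> \<le> (LINT x:{0<..<1}|lborel. D * exp (\<omega> * t) * x powr (q - 1))"
  proof (rule set_integral_mono)
    show "set_integrable lborel {0<..<1} (\<lambda>x. norm (x powr (q - 1) *\<^sub>R (w1 (t * x) - w2 (t * x))))"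
      by (rule set_integrable_norm[OF int])
    show "set_integrable lborel {0<..<1} (\<lambda>x. D * exp (\<omega> * t) * x powr (q - 1))"
      by (intro set_integrable_mult_right set_integrable_powr01)
    fix x :: real assume x: "x \<in> {0<..<1}"
    have "norm (w1 (t * x) - w2 (t * x)) \<le> D * exp (\<omega> * (t * x))" by (rule D[OF mem[OF x]])
    also have "\<dots> \<le> D * exp (\<omega> * t)"
      using x \<omega> t D0 mult_left_mono[of x 1 t] by (intro mult_left_mono) auto
    finally show "norm (x powr (q - 1) *\<^sub>R (w1 (t * x) - w2 (t * x))) \<le> D * exp (\<omega> * t) * x powr (q - 1)"
      by (simp add: mult.commute mult_left_mono)
  qed
    also have "\<dots> = D * exp (\<omega> * t) * Beta q 1"
    by (subst set_integral_mult_right) (simp add: set_integral_powr01)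
    finally show ?thesis .
  qed
  finally have "norm (U w1 t - U w2 t) \<le> t powr q * (D * exp (\<omega> * t) * Beta q 1)"
    by (simp add: mult_left_mono)
  also have "\<dots> \<le> T powr q * (D * exp (\<omega> * t) * Beta q 1)"
    using t q D0 by (intro mult_right_mono powr_mono2 mult_nonneg_nonneg)
      (auto simp: Beta_def Gamma_real_pos less_imp_le)
  finally show ?thesis by (simp add: mult_ac)
qed

text \<open>The bound \<open>Gamma q / 2\<close> meets the factor \<open>1 / Gamma q\<close> in
  \<open>W\<close> and leaves 1 / 2, both for the invariance of the ball and for the
  contraction.\<close>

lemma exists_small_weight: "\<exists>\<omega>>0. T powr (q / 2) * Beta q (q / 2) * \<omega> powr (- q / 2) * c \<le> Gamma q / 2"
proof -
  have "((\<lambda>\<omega>. T powr (q / 2) * Beta q (q / 2) * \<omega> powr (- q / 2) * c) \<longlongrightarrow>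
      T powr (q / 2) * Beta q (q / 2) * 0 * c) at_top"
    using q by (intro tendsto_intros tendsto_neg_powr filterlim_ident) auto
  from order_tendstoD(2)[OF this, of "Gamma q / 2"]
  have "eventually (\<lambda>\<omega>. T powr (q / 2) * Beta q (q / 2) * \<omega> powr (- q / 2) * c < Gamma q / 2) at_top"
    using Gamma_q by simp
  then have "eventually (\<lambda>\<omega>. T powr (q / 2) * Beta q (q / 2) * \<omega> powr (- q / 2) * c < Gamma q / 2 \<and> 0 < \<omega>) at_top"
    using eventually_gt_at_top by eventually_elim auto
  then show ?thesis using less_imp_le by (auto dest!: eventually_happens'[rotated])
qed

text \<open>
  Two weights are needed: with \<open>exp (\<omega> * t)\<close> the operator maps a ball to itself, and \<open>W\<close> is Lipschitz
  only on that ball, with a constant that depends on \<open>\<omega>\<close>; a larger \<open>\<mu>\<close> then makes it a contraction.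
\<close>

lemma W_fixed_point:
  obtains w where "continuous_on {0..T} w" "\<And>t. t \<in> {0..T} \<Longrightarrow> W w t = w t"
proof -
  define c where "c = T powr (q / 2) * Beta q (q / 2)"
  obtain \<omega> where \<omega>: "0 < \<omega>" "c * \<omega> powr (- q / 2) * L \<le> Gamma q / 2"
    using exists_small_weight[of L] unfolding c_def by blast
  \<comment> \<open>In the norm weighted by \<open>exp (\<omega> * t)\<close> the ball of radius
    \<open>N\<close> is invariant: the term \<open>F u0\<close> and the integral each contribute at
    most half of it.\<close>
  define N where "N = 2 * norm (F u0) / Gamma q"
  have N: "0 \<le> N" using Gamma_q by (simp add: N_def)
  \<comment> \<open>\<open>L\<close> accounts for the change of the vector to which
    \<open>F'\<close> is applied, the second summand for the change of the point at which
    \<open>F'\<close> is taken, times the largest value of \<open>w\<close> on the ball.\<close>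
  define L' where "L' = L + M * (T powr q * Beta q 1) * (N * exp (\<omega> * T))"
  obtain \<mu> where \<mu>: "0 < \<mu>" "c * \<mu> powr (- q / 2) * L' \<le> Gamma q / 2"
    using exists_small_weight[of L'] unfolding c_def by blast
  \<comment> \<open>Clamping time to \<open>{0..T}\<close> turns functions on the interval into
    bounded continuous functions on the line, which form a complete space.\<close>
  define p where "p t = max 0 (min T t)" for t
  have p: "p t \<in> {0..T}" "t \<in> {0..T} \<Longrightarrow> p t = t" for t using T by (auto simp: p_def)
  \<comment> \<open>The weight is built into the unknown, so that the plain supremum distance of
    \<open>z\<close> is the distance of \<open>w\<close> weighted by
    \<open>exp (\<mu> * t)\<close>.\<close>
  define wof where "wof z t = exp (\<mu> * t) *\<^sub>R apply_bcontfun z t" for z :: "real \<Rightarrow>\<^sub>C 'a" and t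
  have wof: "continuous_on {0..T} (wof z)" for z unfolding wof_def[abs_def] by (intro continuous_intros continuous_on_apply_bcontfun)
  define S where "S z = Bcontfun (\<lambda>t. exp (- \<mu> * p t) *\<^sub>R W (wof z) (p t))" for z
  have S: "apply_bcontfun (S z) t = exp (- \<mu> * p t) *\<^sub>R W (wof z) (p t)" for z t
  proof -
    have "continuous_on {0..T} (\<lambda>t. exp (- \<mu> * t) *\<^sub>R W (wof z) t)"
      by (intro continuous_intros continuous_on_W wof)
    moreover have "continuous_on UNIV p" unfolding p_def[abs_def] by (intro continuous_intros)
    moreover have "range p \<subseteq> {0..T}" using p(1) by blast
    ultimately have "continuous_on UNIV (\<lambda>t. exp (- \<mu> * p t) *\<^sub>R W (wof z) (p t))"
      using continuous_on_compose2[of "{0..T}" "\<lambda>t. exp (- \<mu> * t) *\<^sub>R W (wof z) t" UNIV p] by simp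
    moreover have "bounded (range (\<lambda>t. exp (- \<mu> * p t) *\<^sub>R W (wof z) (p t)))"
      by (rule bounded_subset[OF compact_imp_bounded[OF compact_continuous_image[OF
          \<open>continuous_on {0..T} (\<lambda>t. exp (- \<mu> * t) *\<^sub>R W (wof z) t)\<close> compact_Icc]]]) (use p(1) in auto)
    ultimately show ?thesis
      unfolding S_def by (subst Bcontfun_inverse) (auto simp: bcontfun_def)
  qed
  define B where "B = {z. \<forall>t\<in>{0..T}. norm (wof z t) \<le> N * exp (\<omega> * t)}"
  have "closed {z. norm (wof z t) \<le> N * exp (\<omega> * t)}" for t
  proof -
    have "continuous_on UNIV (\<lambda>z :: real \<Rightarrow>\<^sub>C 'a. apply_bcontfun z t)"
    proof (rule continuous_onI)
      fix z :: "real \<Rightarrow>\<^sub>C 'a" and \<epsilon> :: real assume "0 < \<epsilon>"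
      then show "\<exists>d>0. \<forall>z'\<in>UNIV. dist z' z < d \<longrightarrow> dist (apply_bcontfun z' t) (apply_bcontfun z t) \<le> \<epsilon>"
        using order.trans[OF dist_bounded less_imp_le] by blast
    qed
    then show ?thesis unfolding wof_def by (intro closed_Collect_le continuous_intros)
  qed
  then have "closed (\<Inter>t\<in>{0..T}. {z. norm (wof z t) \<le> N * exp (\<omega> * t)})" by blast
  moreover have "(\<Inter>t\<in>{0..T}. {z. norm (wof z t) \<le> N * exp (\<omega> * t)}) = B" by (auto simp: B_def)
  ultimately have "closed B" by (simp only:)
  then have cB: "complete B" by (simp add: complete_eq_closed)
  have neB: "B \<noteq> {}"
  proof -
    have "(0 :: real \<Rightarrow>\<^sub>C 'a) \<in> B" using N by (auto simp: B_def wof_def)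
    then show ?thesis by blast
  qed
  have mapB: "S ` B \<subseteq> B"
  proof safe
    fix z assume z: "z \<in> B"
    show "S z \<in> B" unfolding B_def
    proof safe
      fix t assume t: "t \<in> {0..T}"
      have "norm (blinfun_apply (F' (U (wof z) s)) (wof z s)) \<le> (L * N) * exp (\<omega> * s)" if "s \<in> {0..T}" for s
      proof -
        have "norm (blinfun_apply (F' (U (wof z) s)) (wof z s)) \<le> norm (F' (U (wof z) s)) * norm (wof z s)"
          by (rule norm_blinfun)
        also have "\<dots> \<le> L * (N * exp (\<omega> * s))"
          using z that bounded L_nonneg by (intro mult_mono) (auto simp: B_def)
        finally show ?thesis by simp
      qed
      from \<beta>_dilation_bound[OF continuous_on_F'U[OF wof] \<omega>(1) t this]
      have "norm (t powr q *\<^sub>R (LINT x:{0<..<1}|lborel. \<beta> x *\<^sub>R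
          blinfun_apply (F' (U (wof z) (t * x))) (wof z (t * x)))) \<le> c * \<omega> powr (- q / 2) * L * (N * exp (\<omega> * t))"
        by (simp add: c_def mult_ac)
      also have "\<dots> \<le> Gamma q / 2 * (N * exp (\<omega> * t))"
        using \<omega>(2) N by (intro mult_right_mono) auto
      finally have 1: "norm (t powr q *\<^sub>R (LINT x:{0<..<1}|lborel. \<beta> x *\<^sub>R
          blinfun_apply (F' (U (wof z) (t * x))) (wof z (t * x)))) \<le> \<dots>" .
      have "norm (F u0) = Gamma q / 2 * (N * 1)" using Gamma_q by (simp add: N_def less_imp_neq[symmetric])
      also have "\<dots> \<le> Gamma q / 2 * (N * exp (\<omega> * t))"
        using N \<omega>(1) t Gamma_q by (intro mult_left_mono) auto
      finally have "norm (F u0 + t powr q *\<^sub>R (LINT x:{0<..<1}|lborel. \<beta> x *\<^sub>R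
          blinfun_apply (F' (U (wof z) (t * x))) (wof z (t * x)))) \<le> Gamma q * (N * exp (\<omega> * t))"
        using 1 by (intro norm_triangle_le) simp
      then have "norm (W (wof z) t) \<le> N * exp (\<omega> * t)"
        using Gamma_q by (simp add: W_def pos_divide_le_eq mult.commute[of "Gamma q"])
      then show "norm (wof (S z) t) \<le> N * exp (\<omega> * t)"
        using p(2)[OF t] by (simp add: wof_def S exp_minus)
    qed
  qed
  have contr: "dist (S z1) (S z2) \<le> 1 / 2 * dist z1 z2" if z: "z1 \<in> B" "z2 \<in> B" for z1 z2
  proof (rule dist_bound)
    fix t0 :: real
    define t where "t = p t0"
    have t: "t \<in> {0..T}" using p(1) by (simp add: t_def)
    define D where "D = dist z1 z2"
    have diff: "norm (wof z1 s - wof z2 s) \<le> D * exp (\<mu> * s)" for s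
    proof -
      have "norm (wof z1 s - wof z2 s) = exp (\<mu> * s) * dist (z1 s) (z2 s)"
        by (simp add: wof_def dist_norm flip: scaleR_diff_right)
      also have "\<dots> \<le> exp (\<mu> * s) * D" unfolding D_def by (intro mult_left_mono dist_bounded) auto
      finally show ?thesis by (simp add: mult.commute)
    qed
    define h where "h z s = blinfun_apply (F' (U (wof z) s)) (wof z s)" for z s
    have h: "continuous_on {0..T} (h z)" for z unfolding h_def[abs_def] by (rule continuous_on_F'U[OF wof])
    have "norm (h z1 s - h z2 s) \<le> (L' * D) * exp (\<mu> * s)" if s: "s \<in> {0..T}" for s
    proof -
      have "h z1 s - h z2 s = blinfun_apply (F' (U (wof z1) s)) (wof z1 s - wof z2 s) +
          blinfun_apply (F' (U (wof z1) s) - F' (U (wof z2) s)) (wof z2 s)"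
        by (simp add: h_def blinfun.diff_left blinfun.diff_right)
      also have "norm \<dots> \<le> norm (F' (U (wof z1) s)) * norm (wof z1 s - wof z2 s) +
          norm (F' (U (wof z1) s) - F' (U (wof z2) s)) * norm (wof z2 s)"
        by (intro norm_triangle_mono norm_blinfun)
      also have "\<dots> \<le> L * (D * exp (\<mu> * s)) +
          (M * (T powr q * Beta q 1 * (D * exp (\<mu> * s)))) * (N * exp (\<omega> * T))"
      proof (intro add_mono mult_mono bounded diff L_nonneg norm_ge_zero)
        show "norm (F' (U (wof z1) s) - F' (U (wof z2) s)) \<le> M * (T powr q * Beta q 1 * (D * exp (\<mu> * s)))"
          using order.trans[OF lipschitz mult_left_mono[OF U_diff_bound[OF wof wof \<mu>(1) s diff] M_nonneg]] .
        then show "0 \<le> M * (T powr q * Beta q 1 * (D * exp (\<mu> * s)))"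
          using norm_ge_zero order.trans by blast
        have "norm (wof z2 s) \<le> N * exp (\<omega> * s)" using z s by (auto simp: B_def)
        also have "\<dots> \<le> N * exp (\<omega> * T)" using N \<omega>(1) s by (intro mult_left_mono) auto
        finally show "norm (wof z2 s) \<le> N * exp (\<omega> * T)" .
      qed
      also have "\<dots> = (L' * D) * exp (\<mu> * s)" by (simp add: L'_def algebra_simps)
      finally show ?thesis .
    qed
    from \<beta>_dilation_bound[OF _ \<mu>(1) t this] h
    have "norm (t powr q *\<^sub>R (LINT x:{0<..<1}|lborel. \<beta> x *\<^sub>R (h z1 (t * x) - h z2 (t * x)))) \<le>
        c * \<mu> powr (- q / 2) * L' * (D * exp (\<mu> * t))"
      by (simp add: c_def mult_ac continuous_on_diff)
    also have "\<dots> \<le> Gamma q / 2 * (D * exp (\<mu> * t))"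
      using \<mu>(2) by (intro mult_right_mono) (auto simp: D_def)
    finally have *: "norm (t powr q *\<^sub>R (LINT x:{0<..<1}|lborel. \<beta> x *\<^sub>R (h z1 (t * x) - h z2 (t * x)))) \<le> \<dots>" .
    have "W (wof z1) t - W (wof z2) t =
        (1 / Gamma q) *\<^sub>R (t powr q *\<^sub>R (LINT x:{0<..<1}|lborel. \<beta> x *\<^sub>R (h z1 (t * x) - h z2 (t * x))))"
      using set_integral_diff(2)[OF set_integrable_dilation[OF set_integrable_\<beta> h[of z1] t]
          set_integrable_dilation[OF set_integrable_\<beta> h[of z2] t]]
      by (simp add: W_def h_def scaleR_diff_right scaleR_add_right)
    then have "norm (W (wof z1) t - W (wof z2) t) =
        norm (t powr q *\<^sub>R (LINT x:{0<..<1}|lborel. \<beta> x *\<^sub>R (h z1 (t * x) - h z2 (t * x)))) / Gamma q"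
      using Gamma_q by simp
    also have "\<dots> \<le> (Gamma q / 2 * (D * exp (\<mu> * t))) / Gamma q"
      using * Gamma_q by (intro divide_right_mono) auto
    finally have "norm (W (wof z1) t - W (wof z2) t) \<le> D / 2 * exp (\<mu> * t)"
      using Gamma_q by simp
    then have "exp (- \<mu> * t) * norm (W (wof z1) t - W (wof z2) t) \<le> exp (- \<mu> * t) * (D / 2 * exp (\<mu> * t))"
      by (intro mult_left_mono) auto
    also have "\<dots> = D / 2" by (simp add: exp_minus)
    finally have "exp (- \<mu> * t) * norm (W (wof z1) t - W (wof z2) t) \<le> D / 2" .
    moreover have "dist (S z1 t0) (S z2 t0) = exp (- \<mu> * t) * norm (W (wof z1) t - W (wof z2) t)"
      unfolding S dist_norm t_def[symmetric] scaleR_diff_right[symmetric] by simp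
    ultimately show "dist (S z1 t0) (S z2 t0) \<le> 1 / 2 * dist z1 z2" by (simp add: D_def)
  qed
  have "\<exists>!z\<in>B. S z = z" by (rule Banach_fix[OF cB neB _ _ mapB contr]) simp_all
  then obtain z where "S z = z" by blast
  have "W (wof z) t = wof z t" if "t \<in> {0..T}" for t
  proof -
    have "wof z t = exp (\<mu> * t) *\<^sub>R apply_bcontfun (S z) t" by (simp add: wof_def \<open>S z = z\<close>)
    then show ?thesis using p(2)[OF that] by (simp add: S exp_minus)
  qed
  then show thesis using that wof by blast
qed

text \<open>The fixed point equation expresses \<open>v\<close> by a fractional integral of
  \<open>g\<close>, the derivative of \<open>F (u t)\<close>. Integrating against
  \<open>(t - s) powr (-q)\<close> turns this into the ordinary integral of \<open>g\<close>, which
  is \<open>F (u t) - F u0\<close>, and the free term supplies the missing \<open>F u0\<close>. The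
  horizon is excluded because the derivative is two-sided.\<close>

theorem caputo_ivp_exists:
  obtains u v where "u 0 = u0" "\<And>S. S < T \<Longrightarrow> caputo_path q u v S"
    "\<And>t. t \<in> {0<..<T} \<Longrightarrow> caputo_op q v t = F (u t)"
proof -
  obtain w where w: "continuous_on {0..T} w" "\<And>t. t \<in> {0..T} \<Longrightarrow> W w t = w t"
    using W_fixed_point by metis
  define u where "u = U w"
  define v where "v t = t powr (q - 1) *\<^sub>R w t" for t
  define g where "g t = blinfun_apply (F' (u t)) (v t)" for t
  have u_cont: "continuous_on {0..T} u" unfolding u_def by (rule continuous_on_U[OF w(1)])
  have u_0: "u 0 = u0" by (simp add: u_def U_def)
  have gw_cont: "continuous_on {0..T} (\<lambda>s. blinfun_apply (F' (u s)) (w s))"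
    unfolding u_def by (rule continuous_on_F'U[OF w(1)])
  have g_eq: "g t = t powr (q - 1) *\<^sub>R blinfun_apply (F' (u t)) (w t)" for t
    by (simp add: g_def v_def blinfun.scaleR_right)
  have scale: "set_integrable lborel {0<..<t} (\<lambda>s. s powr (q - 1) *\<^sub>R f s)" (is ?A)
      "(LINT s:{0<..<t}|lborel. s powr (q - 1) *\<^sub>R f s) =
        t powr q *\<^sub>R (LINT x:{0<..<1}|lborel. x powr (q - 1) *\<^sub>R f (t * x))" (is ?B)
    if f: "continuous_on {0..T} f" and t: "t \<in> {0<..T}" for f :: "real \<Rightarrow> 'a" and t
  proof -
    have t': "0 < t" "t \<in> {0..T}" using t by auto
    have eq: "(t * x) powr (q - 1) *\<^sub>R f (t * x) = t powr (q - 1) *\<^sub>R (x powr (q - 1) *\<^sub>R f (t * x))"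
      if "x \<in> {0<..<1}" for x
      using that t' by (simp add: powr_mult)
    have int: "set_integrable lborel {0<..<1} (\<lambda>x. t powr (q - 1) *\<^sub>R (x powr (q - 1) *\<^sub>R f (t * x)))"
      by (intro set_integrable_scaleR_right set_integrable_dilation[OF set_integrable_powr01 f t'(2)])
    show ?A
      using int set_integrable_Ioo_rescale[OF t'(1), of "\<lambda>s. s powr (q - 1) *\<^sub>R f s"] eq
      by (subst (asm) set_integrable_cong[OF refl refl eq[symmetric]]) auto
    have "(LINT x:{0<..<1}|lborel. (t * x) powr (q - 1) *\<^sub>R f (t * x)) =
        (LINT x:{0<..<1}|lborel. t powr (q - 1) *\<^sub>R (x powr (q - 1) *\<^sub>R f (t * x)))"
      using eq by (intro set_lebesgue_integral_cong) auto
    also have "\<dots> = t powr (q - 1) *\<^sub>R (LINT x:{0<..<1}|lborel. x powr (q - 1) *\<^sub>R f (t * x))"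
      by (rule set_integral_scaleR_right)
    finally have rescaled: "(LINT x:{0<..<1}|lborel. (t * x) powr (q - 1) *\<^sub>R f (t * x)) = \<dots>" .
    have "(LINT s:{0<..<t}|lborel. s powr (q - 1) *\<^sub>R f s) =
        t *\<^sub>R (LINT x:{0<..<1}|lborel. (t * x) powr (q - 1) *\<^sub>R f (t * x))"
      unfolding set_integral_Ioo_rescale[OF t'(1)] by simp
    also have "\<dots> = (t * t powr (q - 1)) *\<^sub>R (LINT x:{0<..<1}|lborel. x powr (q - 1) *\<^sub>R f (t * x))"
      unfolding rescaled by (rule scaleR_scaleR)
    also have "t * t powr (q - 1) = t powr q" using powr_mult_base[of t "q - 1"] t'(1) by simp
    finally show ?B .
  qed
  have v_int: "set_integrable lborel {0<..<t} v" and u_eq: "u t = u0 + (LINT s:{0<..<t}|lborel. v s)"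
      and g_int: "set_integrable lborel {0<..<t} g"
    if "t \<in> {0<..T}" for t
    using scale[OF w(1) that] scale[OF gw_cont that]
    by (simp_all add: v_def[abs_def] u_def U_def g_eq[abs_def])
  have u_deriv: "(u has_vector_derivative v t) (at t)" if t: "t \<in> {0<..<T}" for t
  proof -
    have int: "v integrable_on {0..T}"
      unfolding integrable_on_Icc_iff_Ioo
      by (rule set_borel_integral_eq_integral(1)[OF v_int]) (use T in simp)
    have "continuous (at t) v"
    proof -
      have "continuous_on {0<..<T} v"
        unfolding v_def[abs_def] by (intro continuous_intros continuous_on_subset[OF w(1)]) auto
      then show ?thesis using t by (simp add: continuous_on_eq_continuous_at)
    qed
    then have "continuous (at t within {0..T} - {}) v" by (rule continuous_at_imp_continuous_within)
    then have "((\<lambda>s. integral {0..s} v) has_vector_derivative v t) (at t within {0..T} - {})"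
      using t by (intro integral_has_vector_derivative_continuous_at[OF int]) auto
    then have "((\<lambda>s. u0 + integral {0..s} v) has_vector_derivative v t) (at t within {0..T})"
      by (auto intro!: derivative_eq_intros)
    moreover have "at t within {0..T} = at t" using t by (intro at_within_interior) auto
    ultimately have "((\<lambda>s. u0 + integral {0..s} v) has_vector_derivative v t) (at t)" by simp
    then show ?thesis
    proof (rule has_vector_derivative_transform_within_open[of _ _ _ "{0<..<T}"])
      fix s assume s: "s \<in> {0<..<T}"
      then show "u0 + integral {0..s} v = u s"
        using u_eq[of s] set_borel_integral_eq_integral(2)[OF v_int[of s]] integral_open_interval_real[of 0 s v]
        by auto
    qed (use t in auto)
  qed
  have g_integral: "(LINT s:{0<..<t}|lborel. g s) = F (u t) - F u0" if t: "t \<in> {0<..<T}" for t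
  proof -
    have "continuous_on UNIV F"
      using F' by (auto intro: has_derivative_continuous simp: continuous_on_eq_continuous_at)
    then have "continuous_on {0..t} (\<lambda>s. F (u s))"
      by (rule continuous_on_compose2) (use t in \<open>auto intro: continuous_on_subset[OF u_cont]\<close>)
    moreover have "((\<lambda>s. F (u s)) has_vector_derivative g s) (at s)" if "s \<in> {0<..<t}" for s
    proof -
      have "(u has_derivative (\<lambda>h. h *\<^sub>R v s)) (at s)"
        using u_deriv[of s] that t by (auto simp: has_vector_derivative_def)
      from has_derivative_compose[OF this F'] show ?thesis
        by (simp add: has_vector_derivative_def g_def blinfun.scaleR_right)
    qed
    ultimately have "(g has_integral (F (u t) - F (u 0))) {0..t}"
      by (intro fundamental_theorem_of_calculus_interior) (use t in auto)
    then have "integral {0<..<t} g = F (u t) - F (u 0)"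
      unfolding has_integral_Icc_iff_Ioo by (rule integral_unique)
    then show ?thesis
      using set_borel_integral_eq_integral(2)[OF g_int[of t]] t by (simp add: u_0)
  qed
  \<comment> \<open>The equation \<open>W w = w\<close> with the scaling undone; the term with
    \<open>F u0\<close> is the boundary term that arises when the fractional integral of
    \<open>F u\<close> is differentiated.\<close>
  have v_eq: "v t = (1 / Gamma q) *\<^sub>R (t powr (q - 1) *\<^sub>R F u0 +
      (LINT r:{0<..<t}|lborel. (t - r) powr (q - 1) *\<^sub>R g r))" if t: "t \<in> {0<..<T}" for t
  proof -
    define I where "I = (LINT x:{0<..<1}|lborel. \<beta> x *\<^sub>R blinfun_apply (F' (u (t * x))) (w (t * x)))"
    have "(LINT r:{0<..<t}|lborel. (t - r) powr (q - 1) *\<^sub>R g r) =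
        t *\<^sub>R (LINT x:{0<..<1}|lborel. (t - t * x) powr (q - 1) *\<^sub>R g (t * x))"
      using t set_integral_Ioo_rescale[of 0 t "\<lambda>r. (t - r) powr (q - 1) *\<^sub>R g r"] by simp
    also have "(LINT x:{0<..<1}|lborel. (t - t * x) powr (q - 1) *\<^sub>R g (t * x)) =
        (LINT x:{0<..<1}|lborel. (t powr (q - 1) * t powr (q - 1)) *\<^sub>R
          (\<beta> x *\<^sub>R blinfun_apply (F' (u (t * x))) (w (t * x))))"
    proof (intro set_lebesgue_integral_cong allI impI)
      fix x :: real assume "x \<in> {0<..<1}"
      moreover have "t - t * x = t * (1 - x)" by (simp add: algebra_simps)
      ultimately show "(t - t * x) powr (q - 1) *\<^sub>R g (t * x) = (t powr (q - 1) * t powr (q - 1)) *\<^sub>R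
          (\<beta> x *\<^sub>R blinfun_apply (F' (u (t * x))) (w (t * x)))"
        using t by (simp add: g_eq powr_mult \<beta>_def mult_ac)
    qed auto
    also have "\<dots> = (t powr (q - 1) * t powr (q - 1)) *\<^sub>R I"
      unfolding I_def by (rule set_integral_scaleR_right)
    also have "t *\<^sub>R \<dots> = t powr (q - 1) *\<^sub>R t powr q *\<^sub>R I"
      using t powr_mult_base[of t "q - 1"] by (simp add: mult_ac)
    finally have "t powr (q - 1) *\<^sub>R F u0 + (LINT r:{0<..<t}|lborel. (t - r) powr (q - 1) *\<^sub>R g r) =
        t powr (q - 1) *\<^sub>R (F u0 + t powr q *\<^sub>R I)"
      by (simp add: scaleR_add_right)
    moreover have "v t = t powr (q - 1) *\<^sub>R W w t" using w(2)[of t] t by (simp add: v_def)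
    ultimately show ?thesis by (simp add: W_def I_def u_def)
  qed
  have op: "set_integrable lborel {0<..<t} (\<lambda>s. (t - s) powr (-q) *\<^sub>R v s)"
      "caputo_op q v t = F (u t)" if t: "t \<in> {0<..<T}" for t
  proof -
    have t': "0 < t" "t \<in> {0<..T}" using t by auto
    have G: "0 < Gamma (1 - q)" using q by (intro Gamma_real_pos) auto
    define J where "J s = (LINT r:{0<..<s}|lborel. (s - r) powr (q - 1) *\<^sub>R g r)" for s
    have eq: "(t - s) powr (-q) *\<^sub>R v s = (1 / Gamma q) *\<^sub>R
        (((t - s) powr (1 - q - 1) * (s - 0) powr (q - 1)) *\<^sub>R F u0 + (t - s) powr (-q) *\<^sub>R J s)"
      if "s \<in> {0<..<t}" for s
      using v_eq[of s] that t by (simp add: J_def scaleR_add_right mult.commute)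
    have 1: "set_integrable lborel {0<..<t} (\<lambda>s. ((t - s) powr (1 - q - 1) * (s - 0) powr (q - 1)) *\<^sub>R F u0)"
    proof -
      have "integrable lborel (\<lambda>s. (indicator {0<..<t} s *\<^sub>R
          ((t - s) powr (1 - q - 1) * (s - 0) powr (q - 1))) *\<^sub>R F u0)"
        using set_integrable_Beta_Ioo[of q "1 - q" 0 t, unfolded set_integrable_def] q t'(1)
        by (intro integrable_scaleR_left) auto
      then show ?thesis by (simp add: set_integrable_def)
    qed
    have 2: "set_integrable lborel {0<..<t} (\<lambda>s. (t - s) powr (-q) *\<^sub>R J s)"
      unfolding J_def by (rule set_integrable_fractional_semigroup[OF q t'(1) g_int[OF t'(2)]])
    have "set_integrable lborel {0<..<t} (\<lambda>s. (1 / Gamma q) *\<^sub>R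
        (((t - s) powr (1 - q - 1) * (s - 0) powr (q - 1)) *\<^sub>R F u0 + (t - s) powr (-q) *\<^sub>R J s))"
      by (intro set_integrable_scaleR_right set_integral_add(1) 1 2)
    then show "set_integrable lborel {0<..<t} (\<lambda>s. (t - s) powr (-q) *\<^sub>R v s)"
      by (subst set_integrable_cong[OF refl refl eq])
    have "(LINT s:{0<..<t}|lborel. ((t - s) powr (1 - q - 1) * (s - 0) powr (q - 1)) *\<^sub>R F u0) =
        (LINT s:{0<..<t}|lborel. (t - s) powr (1 - q - 1) * (s - 0) powr (q - 1)) *\<^sub>R F u0"
      using set_integrable_Beta_Ioo[of q "1 - q" 0 t, unfolded set_integrable_def] q t'(1)
      by (simp add: set_lebesgue_integral_def flip: integral_scaleR_left)
    also have "\<dots> = (Gamma q * Gamma (1 - q)) *\<^sub>R F u0"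
      using set_integral_Beta_Ioo[of q "1 - q" 0 t] q t' by (simp add: Beta_one_minus)
    finally have 3: "(LINT s:{0<..<t}|lborel. ((t - s) powr (1 - q - 1) * (s - 0) powr (q - 1)) *\<^sub>R F u0) = \<dots>" .
    have "(LINT s:{0<..<t}|lborel. (t - s) powr (-q) *\<^sub>R v s) =
        (LINT s:{0<..<t}|lborel. (1 / Gamma q) *\<^sub>R
          (((t - s) powr (1 - q - 1) * (s - 0) powr (q - 1)) *\<^sub>R F u0 + (t - s) powr (-q) *\<^sub>R J s))"
      by (intro set_lebesgue_integral_cong allI impI eq) auto
    also have "\<dots> = (1 / Gamma q) *\<^sub>R
        ((Gamma q * Gamma (1 - q)) *\<^sub>R F u0 + (LINT s:{0<..<t}|lborel. (t - s) powr (-q) *\<^sub>R J s))"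
      unfolding set_integral_scaleR_right set_integral_add(2)[OF 1 2] 3 ..
    also have "(LINT s:{0<..<t}|lborel. (t - s) powr (-q) *\<^sub>R J s) = (Gamma q * Gamma (1 - q)) *\<^sub>R (F (u t) - F u0)"
      unfolding J_def set_integral_fractional_semigroup[OF q t'(1) g_int[OF t'(2)]] g_integral[OF t] ..
    finally have "(LINT s:{0<..<t}|lborel. (t - s) powr (-q) *\<^sub>R v s) = Gamma (1 - q) *\<^sub>R F (u t)"
      using Gamma_q by (simp add: scaleR_diff_right)
    then show "caputo_op q v t = F (u t)" using G by (simp add: caputo_op_def)
  qed
  have "caputo_path q u v S" if "S < T" for S
    using that u_deriv op(1) continuous_on_subset[OF u_cont] by (auto simp: caputo_path_def)
  then show thesis by (rule that[OF u_0 _ op(2)])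
qed

end

section \<open>Global solutions and instability\<close>

text \<open>Beyond \<open>R\<close> the identity is continued by \<open>R + sin (x - R)\<close>, and
  symmetrically below \<open>- R\<close>. Slope 1 matches at the joints, the values stay bounded,
  and the derivative is Lipschitz because cosine is.\<close>

lemma C1_cutoff_real:
  fixes R :: real
  assumes "0 \<le> R"
  obtains \<tau> \<tau>' :: "real \<Rightarrow> real"
  where "\<And>x. (\<tau> has_real_derivative \<tau>' x) (at x)" "\<And>x. \<bar>x\<bar> \<le> R \<Longrightarrow> \<tau> x = x"
    "\<And>x. \<bar>\<tau> x\<bar> \<le> R + 1" "\<And>x. \<bar>\<tau>' x\<bar> \<le> 5" "\<And>x y. \<bar>\<tau>' x - \<tau>' y\<bar> \<le> 2 * \<bar>x - y\<bar>"
    "\<And>x y. \<bar>\<tau> x - \<tau> y\<bar> \<le> 5 * \<bar>x - y\<bar>"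
proof -
  define g :: "real \<Rightarrow> real" where "g y = max y 0 - sin (max y 0)" for y
  have g: "(g has_real_derivative 1 - cos (max y 0)) (at y)" for y
  proof (cases y "0 :: real" rule: linorder_cases)
    case less
    have "((\<lambda>_. 0) has_real_derivative 1 - cos (max y 0)) (at y)" using less by (simp add: max_def)
    then show ?thesis
      by (rule has_field_derivative_transform_within_open[of _ _ _ "{..<0}"]) (use less in \<open>auto simp: g_def\<close>)
  next
    case greater
    have "((\<lambda>y. y - sin y) has_real_derivative 1 - cos (max y 0)) (at y)"
      using greater by (auto intro!: derivative_eq_intros simp: max_def)
    then show ?thesis
      by (rule has_field_derivative_transform_within_open[of _ _ _ "{0<..}"]) (use greater in \<open>auto simp: g_def\<close>)
  next
    case equal
    have "((\<lambda>y :: real. y - sin y) has_real_derivative 0) (at 0)"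
      by (auto intro!: derivative_eq_intros)
    then have "((\<lambda>y :: real. (y - sin y) / y) \<longlongrightarrow> 0) (at 0)" by (simp add: has_field_derivative_iff)
    then have "((\<lambda>y :: real. \<bar>(y - sin y) / y\<bar>) \<longlongrightarrow> 0) (at 0)" by (rule tendsto_rabs_zero)
    then have "((\<lambda>y. g y / y) \<longlongrightarrow> 0) (at 0)"
    proof (rule Lim_null_comparison[rotated], intro always_eventually allI)
      show "norm (g y / y) \<le> \<bar>(y - sin y) / y\<bar>" for y
        by (cases "0 \<le> y") (simp_all add: g_def max_def del: abs_divide)
    qed
    then show ?thesis using equal by (simp add: has_field_derivative_iff g_def)
  qed
  define \<tau> where "\<tau> x = x - g (x - R) + g (- x - R)" for x
  define \<tau>' where "\<tau>' x = cos (max (x - R) 0) + cos (max (- x - R) 0) - 1" for x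
  have der: "(\<tau> has_real_derivative \<tau>' x) (at x)" for x
    unfolding \<tau>_def[abs_def] \<tau>'_def
    by (auto intro!: derivative_eq_intros DERIV_chain2[OF g])
  have bound: "\<bar>\<tau>' x\<bar> \<le> 5" for x
    using abs_cos_le_one[of "max (x - R) 0"] abs_cos_le_one[of "max (- x - R) 0"] unfolding \<tau>'_def by linarith
  have cos: "\<bar>cos a - cos b\<bar> \<le> \<bar>a - b\<bar>" for a b :: real
    using field_differentiable_bound[of UNIV cos "\<lambda>x. - sin x" 1 a b]
    by (auto intro!: derivative_eq_intros simp: abs_sin_le_one)
  have lip: "\<bar>\<tau>' x - \<tau>' y\<bar> \<le> 2 * \<bar>x - y\<bar>" for x y
    using cos[of "max (x - R) 0" "max (y - R) 0"] cos[of "max (- x - R) 0" "max (- y - R) 0"]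
    unfolding \<tau>'_def by (simp add: abs_if max_def split: if_splits)
  have lip': "\<bar>\<tau> x - \<tau> y\<bar> \<le> 5 * \<bar>x - y\<bar>" for x y
    using field_differentiable_bound[of UNIV \<tau> \<tau>' 5 x y] der bound by auto
  have "\<bar>\<tau> x\<bar> \<le> R + 1" for x
    using assms unfolding \<tau>_def g_def max_def by (smt (verit) sin_ge_minus_one sin_le_one sin_zero)
  moreover have "\<tau> x = x" if "\<bar>x\<bar> \<le> R" for x using that by (auto simp: \<tau>_def g_def max_def)
  ultimately show thesis using der bound lip lip' by (intro that[of \<tau> \<tau>'])
qed

text \<open>The scalar cutoff is applied to each coordinate; no coordinate exceeds the norm, so the
  ball of radius \<open>R\<close> is fixed pointwise.\<close>

lemma C1_cutoff:
  fixes R :: real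
  assumes R: "0 \<le> R"
  obtains P :: "'a::euclidean_space \<Rightarrow> 'a" and P' :: "'a \<Rightarrow> 'a \<Rightarrow>\<^sub>L 'a" and c
  where "\<And>x. (P has_derivative blinfun_apply (P' x)) (at x)" "\<And>x. norm x \<le> R \<Longrightarrow> P x = x"
    "\<And>x. norm (P x) \<le> c" "\<And>x. norm (P' x) \<le> c" "\<And>x y. norm (P' x - P' y) \<le> c * norm (x - y)"
    "\<And>x y. norm (P x - P y) \<le> c * norm (x - y)" "0 \<le> c"
proof -
  obtain \<tau> \<tau>' :: "real \<Rightarrow> real" where
    \<tau>: "\<And>x. (\<tau> has_real_derivative \<tau>' x) (at x)" "\<And>x. \<bar>x\<bar> \<le> R \<Longrightarrow> \<tau> x = x"
    "\<And>x. \<bar>\<tau> x\<bar> \<le> R + 1" "\<And>x. \<bar>\<tau>' x\<bar> \<le> 5" "\<And>x y. \<bar>\<tau>' x - \<tau>' y\<bar> \<le> 2 * \<bar>x - y\<bar>"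
    "\<And>x y. \<bar>\<tau> x - \<tau> y\<bar> \<le> 5 * \<bar>x - y\<bar>"
    using C1_cutoff_real[OF R] by metis
  define P where "P x = (\<Sum>b\<in>Basis. \<tau> (x \<bullet> b) *\<^sub>R b)" for x :: 'a
  define D where "D x h = (\<Sum>b\<in>Basis. (\<tau>' (x \<bullet> b) * (h \<bullet> b)) *\<^sub>R b)" for x h :: 'a
  have lin: "bounded_linear (D x)" for x unfolding D_def
    by (intro bounded_linear_sum bounded_linear_scaleR_left[THEN bounded_linear_compose]
        bounded_linear_mult_right[THEN bounded_linear_compose] bounded_linear_inner_left)
  define P' where "P' x = Blinfun (D x)" for x
  have P': "blinfun_apply (P' x) = D x" for x unfolding P'_def by (rule bounded_linear_Blinfun_apply[OF lin])
  have sum_bound: "norm (\<Sum>b\<in>Basis. f b *\<^sub>R b :: 'a) \<le> DIM('a) * B" if "\<And>b. b \<in> Basis \<Longrightarrow> \<bar>f b\<bar> \<le> B" for f and B :: real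
  proof -
    have "norm (\<Sum>b\<in>Basis. f b *\<^sub>R b :: 'a) \<le> (\<Sum>b\<in>(Basis :: 'a set). B)"
      by (rule sum_norm_le) (use that in auto)
    then show ?thesis by simp
  qed
  have inner: "\<bar>(x :: 'a) \<bullet> b\<bar> \<le> norm x" if "b \<in> Basis" for x b using Basis_le_norm[OF that] .
  define c where "c = DIM('a) * (R + 5)"
  have c: "real DIM('a) * (R + 1) \<le> c" "real DIM('a) * 5 \<le> c" "real DIM('a) * 2 \<le> c"
    using R by (auto simp: c_def)
  have der: "(P has_derivative blinfun_apply (P' x)) (at x)" for x
    unfolding P_def[abs_def] P' D_def
    by (auto intro!: derivative_eq_intros has_derivative_compose[OF _ \<tau>(1)[unfolded has_field_derivative_def]]
        simp: mult.commute)
  have id: "P x = x" if "norm x \<le> R" for x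
    using \<tau>(2) order.trans[OF inner that] by (simp add: P_def euclidean_representation)
  have "norm (P x) \<le> c" for x
    using sum_bound[of "\<lambda>b. \<tau> (x \<bullet> b)" "R + 1"] \<tau>(3) c(1) unfolding P_def by (meson order.trans)
  moreover have "norm (P' x) \<le> c" for x
  proof (rule norm_blinfun_bound)
    fix h
    have "norm (D x h) \<le> DIM('a) * (5 * norm h)" unfolding D_def
      by (rule sum_bound) (auto simp: abs_mult intro!: mult_mono \<tau>(4) inner)
    also have "\<dots> \<le> c * norm h" using mult_right_mono[OF c(2), of "norm h"] by simp
    finally show "norm (blinfun_apply (P' x) h) \<le> c * norm h" by (simp add: P')
  qed (use R in \<open>simp add: c_def\<close>)
  moreover have "norm (P' x - P' y) \<le> c * norm (x - y)" for x y
  proof (rule norm_blinfun_bound)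
    fix h
    have "D x h - D y h = (\<Sum>b\<in>Basis. ((\<tau>' (x \<bullet> b) - \<tau>' (y \<bullet> b)) * (h \<bullet> b)) *\<^sub>R b)"
      by (simp add: D_def sum_subtractf algebra_simps)
    also have "norm \<dots> \<le> DIM('a) * ((2 * norm (x - y)) * norm h)"
    proof (rule sum_bound)
      fix b :: 'a assume b: "b \<in> Basis"
      have "\<bar>\<tau>' (x \<bullet> b) - \<tau>' (y \<bullet> b)\<bar> \<le> 2 * norm (x - y)"
        using \<tau>(5)[of "x \<bullet> b" "y \<bullet> b"] inner[OF b, of "x - y"] by (simp add: inner_diff_left)
      then show "\<bar>(\<tau>' (x \<bullet> b) - \<tau>' (y \<bullet> b)) * (h \<bullet> b)\<bar> \<le> 2 * norm (x - y) * norm h"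
        unfolding abs_mult by (intro mult_mono inner[OF b]) auto
    qed
    also have "\<dots> \<le> c * norm (x - y) * norm h"
      using mult_right_mono[OF c(3), of "norm (x - y) * norm h"] by (simp add: mult_ac)
    finally show "norm (blinfun_apply (P' x - P' y) h) \<le> c * norm (x - y) * norm h"
      by (simp add: P' blinfun.diff_left)
  qed (use R in \<open>simp add: c_def\<close>)
  moreover have "norm (P x - P y) \<le> c * norm (x - y)" for x y
  proof -
    have "P x - P y = (\<Sum>b\<in>Basis. (\<tau> (x \<bullet> b) - \<tau> (y \<bullet> b)) *\<^sub>R b)"
      by (simp add: P_def sum_subtractf algebra_simps)
    also have "norm \<dots> \<le> DIM('a) * (5 * norm (x - y))"
    proof (rule sum_bound)
      fix b :: 'a assume b: "b \<in> Basis"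
      show "\<bar>\<tau> (x \<bullet> b) - \<tau> (y \<bullet> b)\<bar> \<le> 5 * norm (x - y)"
        using \<tau>(6)[of "x \<bullet> b" "y \<bullet> b"] inner[OF b, of "x - y"] by (simp add: inner_diff_left)
    qed
    also have "\<dots> \<le> c * norm (x - y)" using mult_right_mono[OF c(2), of "norm (x - y)"] by simp
    finally show ?thesis .
  qed
  moreover have "0 \<le> c" using R by (simp add: c_def)
  ultimately show thesis using der id by (intro that[of P P' c])
qed

text \<open>A Lipschitz derivative admits quadratic fields, which are not globally Lipschitz; the
  one-sided energy inequality is what excludes blow-up.\<close>

locale linear_growth_field =
  fixes q k K :: real and f :: "'a::euclidean_space \<Rightarrow> 'a" and f' :: "'a \<Rightarrow> 'a \<Rightarrow>\<^sub>L 'a"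
  assumes q: "0 < q" "q < 1" and k: "0 < k"
    and f': "\<And>u. (f has_derivative blinfun_apply (f' u)) (at u)"
    and lipschitz: "\<And>u w. norm (f' u - f' w) \<le> K * norm (u - w)"
    and energy: "\<And>u. u \<bullet> f u \<le> k * (norm u)\<^sup>2"
begin

lemma K_nonneg: "0 \<le> K"
proof -
  obtain b :: 'a where "b \<in> Basis" using nonempty_Basis by blast
  then show ?thesis using order.trans[OF norm_ge_zero lipschitz[of b 0]] by simp
qed

lemma f'_bound: "norm (f' u) \<le> norm (f' 0) + K * norm u"
  using norm_triangle_sub[of "f' u" "f' 0"] lipschitz[of u 0] by simp

text \<open>The radius \<open>R\<close> is the growth bound for time \<open>T\<close>, computed
  before the field is cut off. Inside that ball the truncated field equals \<open>f\<close> and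
  satisfies the energy inequality, which is all that the growth bound asks for, so the truncated
  solution never leaves the ball.\<close>

lemma local_solution:
  assumes "0 < T"
  obtains u v where "u 0 = u0" "caputo_path q u v T" "\<And>t. t \<in> {0<..T} \<Longrightarrow> caputo_op q v t = f (u t)"
proof -
  define m where "m = norm u0 + 1"
  obtain C where C: "1 \<le> C"
    and growth: "\<And>(u :: real \<Rightarrow> 'a) v T m t. \<lbrakk>caputo_path q u v T; norm (u 0) < m;
      \<And>t. \<lbrakk>t \<in> {0<..T}; norm (u t) \<le> C * m * exp (k powr (1 / q) * T)\<rbrakk> \<Longrightarrow>
        u t \<bullet> caputo_op q v t \<le> k * (norm (u t))\<^sup>2; t \<in> {0..T}\<rbrakk> \<Longrightarrow>
      norm (u t) < C * m * exp (k powr (1 / q) * t)"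
    using caputo_growth_bound[OF q k] by metis
  define R where "R = C * m * exp (k powr (1 / q) * T)"
  have m: "0 < m" by (simp add: m_def add_nonneg_pos)
  have R: "0 \<le> R" using C m by (simp add: R_def)
  obtain P :: "'a \<Rightarrow> 'a" and P' c where P: "\<And>x. (P has_derivative blinfun_apply (P' x)) (at x)"
      "\<And>x. norm x \<le> R \<Longrightarrow> P x = x" "\<And>x. norm (P x) \<le> c" "\<And>x. norm (P' x) \<le> c"
      "\<And>x y. norm (P' x - P' y) \<le> c * norm (x - y)" "\<And>x y. norm (P x - P y) \<le> c * norm (x - y)" "0 \<le> c"
    using C1_cutoff[OF R] by metis
  define L where "L = norm (f' 0) + K * c"
  have L: "norm (f' (P x)) \<le> L" for x
    using f'_bound[of "P x"] mult_left_mono[OF P(3)[of x] K_nonneg] by (simp add: L_def)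
  \<comment> \<open>The horizon is \<open>T + 1\<close> because the existence theorem yields paths
    only on strictly shorter intervals.\<close>
  interpret smooth_caputo_ivp q "T + 1" "L * c" "K * c * c + L * c" "\<lambda>x. f (P x)" "\<lambda>x. f' (P x) o\<^sub>L P' x" u0
  proof
    show "((\<lambda>x. f (P x)) has_derivative blinfun_apply (f' (P u) o\<^sub>L P' u)) (at u)" for u
      using has_derivative_compose[OF P(1) f', of u] by (simp add: blinfun_compose.rep_eq comp_def)
    show "norm (f' (P u) o\<^sub>L P' u) \<le> L * c" for u
      by (rule order.trans[OF norm_blinfun_compose]) (intro mult_mono L P(4) order.trans[OF norm_ge_zero L] norm_ge_zero)
    fix u w
    have "(f' (P u) o\<^sub>L P' u) - (f' (P w) o\<^sub>L P' w) =
        ((f' (P u) - f' (P w)) o\<^sub>L P' u) + (f' (P w) o\<^sub>L (P' u - P' w))"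
      by (rule blinfun_eqI) (simp add: blinfun.diff_left blinfun.add_left blinfun.diff_right)
    also have "norm \<dots> \<le> norm (f' (P u) - f' (P w)) * norm (P' u) + norm (f' (P w)) * norm (P' u - P' w)"
      by (intro norm_triangle_mono norm_blinfun_compose)
    also have "\<dots> \<le> (K * (c * norm (u - w))) * c + L * (c * norm (u - w))"
      using order.trans[OF lipschitz mult_left_mono[OF P(6) K_nonneg], of u w] order.trans[OF norm_ge_zero L] P(7) K_nonneg
      by (intro add_mono mult_mono P(4) P(5) L) auto
    finally show "norm ((f' (P u) o\<^sub>L P' u) - (f' (P w) o\<^sub>L P' w)) \<le> (K * c * c + L * c) * norm (u - w)"
      by (simp add: algebra_simps)
  qed (use q assms in auto)
  obtain u v where u: "u 0 = u0" "\<And>S. S < T + 1 \<Longrightarrow> caputo_path q u v S"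
      "\<And>t. t \<in> {0<..<T + 1} \<Longrightarrow> caputo_op q v t = f (P (u t))"
    using caputo_ivp_exists by metis
  have path: "caputo_path q u v T" by (rule u(2)) simp
  have "norm (u t) \<le> R" if t: "t \<in> {0..T}" for t
  proof -
    have "norm (u t) < C * m * exp (k powr (1 / q) * t)"
    proof (rule growth[OF path _ _ t])
      show "norm (u 0) < m" by (simp add: u(1) m_def)
      fix s assume s: "s \<in> {0<..T}" "norm (u s) \<le> C * m * exp (k powr (1 / q) * T)"
      then show "u s \<bullet> caputo_op q v s \<le> k * (norm (u s))\<^sup>2"
        using u(3)[of s] P(2)[of "u s"] energy[of "u s"] by (simp add: R_def)
    qed
    also have "\<dots> \<le> R" unfolding R_def using t C m by (intro mult_left_mono) (auto intro!: mult_left_mono)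
    finally show ?thesis by simp
  qed
  then have "caputo_op q v t = f (u t)" if "t \<in> {0<..T}" for t
    using u(3)[of t] P(2)[of "u t"] that by auto
  then show thesis using that u(1) path by blast
qed

text \<open>On a ball containing both solutions \<open>f\<close> is Lipschitz with constant
  \<open>L\<close>, so the difference satisfies the energy inequality with \<open>L\<close>. It
  starts at 0, below every \<open>m > 0\<close>, and the growth bound tends to 0 with
  \<open>m\<close>.\<close>

lemma solution_unique:
  assumes "caputo_path q u v T" "caputo_path q u' v' T" "u 0 = u' 0"
    and "\<And>t. t \<in> {0<..T} \<Longrightarrow> caputo_op q v t = f (u t)" "\<And>t. t \<in> {0<..T} \<Longrightarrow> caputo_op q v' t = f (u' t)"
    and t: "t \<in> {0..T}"
  shows "u t = u' t"
proof -
  have "bounded (u ` {0..T} \<union> u' ` {0..T})"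
    using assms(1,2) by (auto simp: caputo_path_def intro!: compact_imp_bounded compact_continuous_image)
  then obtain R where "\<forall>y\<in>u ` {0..T} \<union> u' ` {0..T}. norm y \<le> R"
    unfolding bounded_iff by blast
  then have R: "\<And>t. t \<in> {0..T} \<Longrightarrow> norm (u t) \<le> R" "\<And>t. t \<in> {0..T} \<Longrightarrow> norm (u' t) \<le> R"
    by blast+
  define L where "L = norm (f' 0) + K * R + 1"
  have R0: "0 \<le> R" using order.trans[OF norm_ge_zero R(1)[OF t]] .
  have L: "0 < L" using R0 K_nonneg by (simp add: L_def add_nonneg_pos)
  have lip: "norm (f a - f b) \<le> L * norm (a - b)" if "norm a \<le> R" "norm b \<le> R" for a b
  proof (rule differentiable_bound[of "cball 0 R"])
    show "(f has_derivative blinfun_apply (f' x)) (at x within cball 0 R)" for x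
      using f' by (rule has_derivative_at_withinI)
    show "onorm (blinfun_apply (f' x)) \<le> L" if "x \<in> cball 0 R" for x
      using f'_bound[of x] mult_left_mono[of "norm x" R K] K_nonneg that
      by (simp add: norm_blinfun.rep_eq[symmetric] L_def)
  qed (use that in auto)
  obtain C where C: "1 \<le> C"
    and growth: "\<And>(u :: real \<Rightarrow> 'a) v T m t. \<lbrakk>caputo_path q u v T; norm (u 0) < m;
      \<And>t. \<lbrakk>t \<in> {0<..T}; norm (u t) \<le> C * m * exp (L powr (1 / q) * T)\<rbrakk> \<Longrightarrow>
        u t \<bullet> caputo_op q v t \<le> L * (norm (u t))\<^sup>2; t \<in> {0..T}\<rbrakk> \<Longrightarrow>
      norm (u t) < C * m * exp (L powr (1 / q) * t)"
    using caputo_growth_bound[OF q L] by metis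
  have *: "norm (u t - u' t) < C * m * exp (L powr (1 / q) * t)" if "0 < m" for m
  proof (rule growth[OF caputo_path_diff[OF assms(1,2)] _ _ t])
    show "norm (u 0 - u' 0) < m" using that assms(3) by simp
    fix s assume s: "s \<in> {0<..T}"
    have "(u s - u' s) \<bullet> caputo_op q (\<lambda>t. v t - v' t) s = (u s - u' s) \<bullet> (f (u s) - f (u' s))"
      using caputo_op_diff[OF assms(1,2) s] assms(4,5)[OF s] by simp
    also have "\<dots> \<le> norm (u s - u' s) * (L * norm (u s - u' s))"
      using s by (intro order.trans[OF norm_cauchy_schwarz] mult_left_mono lip R) auto
    finally show "(u s - u' s) \<bullet> caputo_op q (\<lambda>t. v t - v' t) s \<le> L * (norm (u s - u' s))\<^sup>2"
      by (simp add: power2_eq_square mult_ac)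
  qed
  have "norm (u t - u' t) \<le> 0 + e" if "0 < e" for e
  proof -
    define E where "E = C * exp (L powr (1 / q) * t)"
    have "0 < E" using C by (simp add: E_def)
    have "C * (e / E) * exp (L powr (1 / q) * t) = E * (e / E)" unfolding E_def by (simp only: mult_ac)
    then show ?thesis using *[of "e / E"] that \<open>0 < E\<close> by simp
  qed
  then have "norm (u t - u' t) \<le> 0" by (rule field_le_epsilon)
  then show ?thesis by simp
qed

text \<open>The derivative at \<open>t\<close> involves the whole history, so solutions are not
  continued step by step: those on longer and longer intervals from 0 agree by uniqueness.\<close>

theorem global_solution:
  obtains x v where "x 0 = u0" "\<And>T. caputo_path q x v T" "\<And>t. 0 < t \<Longrightarrow> caputo_op q v t = f (x t)"
proof -
  have "\<forall>n :: nat. \<exists>u v. u 0 = u0 \<and> caputo_path q u v (real n + 1) \<and>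
      (\<forall>t\<in>{0<..real n + 1}. caputo_op q v t = f (u t))"
  proof
    fix n :: nat
    have "0 < real n + 1" by simp
    from local_solution[OF this, of u0]
    show "\<exists>u v. u 0 = u0 \<and> caputo_path q u v (real n + 1) \<and> (\<forall>t\<in>{0<..real n + 1}. caputo_op q v t = f (u t))"
      by metis
  qed
  then obtain X V where X: "\<And>n :: nat. X n 0 = u0" "\<And>n. caputo_path q (X n) (V n) (real n + 1)"
      "\<And>n t. t \<in> {0<..real n + 1} \<Longrightarrow> caputo_op q (V n) t = f (X n t)"
    by metis
  have agree: "X n t = X m t" if "t \<in> {0..real n + 1}" "t \<in> {0..real m + 1}" for n m t
    by (rule solution_unique[of "X n" "V n" "min (real n + 1) (real m + 1)" "X m" "V m"])
      (use that X(1,3) in \<open>auto intro: caputo_path_mono[OF X(2)]\<close>)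
  \<comment> \<open>The horizon \<open>real n + 1\<close> exceeds \<open>t\<close> by a margin, so
    near \<open>t\<close> a single \<open>X n\<close> coincides with \<open>x\<close>, as the
    two-sided derivative requires.\<close>
  define x where "x t = X (nat \<lceil>t\<rceil>) t" for t
  define v where "v t = vector_derivative x (at t)" for t
  have x: "x t = X n t" if "t \<in> {0..real n + 1}" for n t
    unfolding x_def using that by (intro agree) (auto, linarith)
  have deriv: "(x has_vector_derivative V n t) (at t)" if "t \<in> {0<..<real n + 1}" for n t
  proof (rule has_vector_derivative_transform_within_open[of "X n" _ _ "{0<..<real n + 1}"])
    show "(X n has_vector_derivative V n t) (at t)" using X(2)[of n] that by (auto simp: caputo_path_def)
    show "X n y = x y" if "y \<in> {0<..<real n + 1}" for y using x[of y n] that by simp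
  qed (use that in auto)
  then have v: "v t = V n t" if "t \<in> {0<..<real n + 1}" for n t
    using that unfolding v_def by (intro vector_derivative_at) auto
  show thesis
  proof
    show "x 0 = u0" by (simp add: x_def X(1))
    fix T :: real
    define n where "n = nat \<lceil>T\<rceil>"
    have n: "T < real n + 1" unfolding n_def by linarith
    have path: "caputo_path q (X n) (V n) T" using n by (intro caputo_path_mono[OF X(2)]) simp
    have "set_integrable lborel {0<..<t} (\<lambda>s. (t - s) powr (-q) *\<^sub>R v s)" if "t \<in> {0<..T}" for t
    proof -
      have "set_integrable lborel {0<..<t} (\<lambda>s. (t - s) powr (-q) *\<^sub>R V n s)"
        using path that by (simp add: caputo_path_def)
      then show ?thesis
      proof (rule set_integrable_cong[THEN iffD1, rotated -1])
        fix s assume "s \<in> {0<..<t}"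
        then show "(t - s) powr (-q) *\<^sub>R V n s = (t - s) powr (-q) *\<^sub>R v s"
          using v[of s n] that n by simp
      qed auto
    qed
    moreover have "continuous_on {0..T} x"
      using path x[of _ n] n by (subst continuous_on_cong[of _ "{0..T}" x "X n"]) (auto simp: caputo_path_def)
    ultimately show "caputo_path q x v T"
      using deriv[of _ n] v[of _ n] n by (auto simp: caputo_path_def)
  next
    fix t :: real assume t: "0 < t"
    define n where "n = nat \<lceil>t\<rceil>"
    have n: "t < real n + 1" unfolding n_def by linarith
    have "caputo_op q v t = caputo_op q (V n) t"
      unfolding caputo_op_def using v[of _ n] n
      by (intro arg_cong[where f = "\<lambda>z. _ *\<^sub>R z"] set_lebesgue_integral_cong) auto
    then show "caputo_op q v t = f (x t)" using X(3)[of t n] x[of t n] t n by simp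
  qed
qed

text \<open>
  Along the expanding direction \<open>e\<close> the solution is compared with
  \<open>d / 2 * exp (\<mu> * t) - K' * d\<^sup>2 * exp (2 * \<mu> * t) + const\<close>. The quadratic error, of size
  \<open>d\<^sup>2 * exp (2 * \<mu> * t)\<close> by the growth bound, is absorbed because \<open>(2 * \<mu>) powr q > k\<close>.
\<close>

lemma escaping_solutions:
  assumes e: "norm e = 1" and Q: "0 \<le> Q" "\<And>u. k * (e \<bullet> u) - Q * (norm u)\<^sup>2 \<le> e \<bullet> f u"
  obtains \<epsilon> where "0 < \<epsilon>" "\<And>\<delta>. 0 < \<delta> \<Longrightarrow> \<exists>x v t. norm (x 0) < \<delta> \<and> (\<forall>T. caputo_path q x v T) \<and>
    (\<forall>t>0. caputo_op q v t = f (x t)) \<and> 0 < t \<and> \<epsilon> \<le> norm (x t)"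
proof -
  define \<mu> where "\<mu> = k powr (1 / q)"
  have \<mu>: "0 < \<mu>" "\<mu> powr q = k" using k q by (auto simp: \<mu>_def powr_powr)
  obtain C where C: "1 \<le> C"
    and growth: "\<And>(u :: real \<Rightarrow> 'a) v T m t. \<lbrakk>caputo_path q u v T; norm (u 0) < m;
      \<And>t. \<lbrakk>t \<in> {0<..T}; norm (u t) \<le> C * m * exp (\<mu> * T)\<rbrakk> \<Longrightarrow>
        u t \<bullet> caputo_op q v t \<le> k * (norm (u t))\<^sup>2; t \<in> {0..T}\<rbrakk> \<Longrightarrow>
      norm (u t) < C * m * exp (\<mu> * t)"
    using caputo_growth_bound[OF q k] unfolding \<mu>_def by metis
  define p where "p = (2 :: real) powr q"
  have p: "1 < p" using gr_one_powr[of 2 q] q by (simp add: p_def)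
  \<comment> \<open>The growth bound will be applied with \<open>m = 2 * d\<close>; hence the factor
    \<open>(2 * C)\<^sup>2\<close> in the quadratic error.\<close>
  define c where "c = Q * (2 * C)\<^sup>2"
  have c: "0 \<le> c" using Q by (simp add: c_def)
  \<comment> \<open>Since \<open>(2 * \<mu>) powr q = p * k\<close>, the quadratic term of the
    barrier gains \<open>K' * k * (p - 1)\<close>; this choice makes the gain \<open>c + 1\<close>,
    more than the error \<open>c\<close>.\<close>
  define K' where "K' = (c + 1) / ((p - 1) * k)"
  have K': "0 < K'" using c p k by (simp add: K'_def)
  have K'k: "K' * k * (p - 1) = c + 1" using p k by (simp add: K'_def)
  show thesis
  proof (rule that[of "1 / (16 * K')"])
    show "0 < 1 / (16 * K')" using K' by simp
    fix \<delta> :: real assume \<delta>: "0 < \<delta>"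
    \<comment> \<open>The second bound gives \<open>K' * p * d \<le> 1 / 8\<close>, so that the
      barrier starts below \<open>d\<close> and the escape time \<open>s\<close> is
      positive.\<close>
    define d where "d = min (\<delta> / 2) (1 / (8 * K' * p))"
    have d: "0 < d" "d < \<delta>" using \<delta> K' p by (auto simp: d_def min_def)
    have "d \<le> 1 / (8 * K' * p)" by (simp add: d_def)
    then have Kpd: "K' * p * d \<le> 1 / 8" using K' p by (simp add: field_simps)
    have "K' * 1 * d \<le> K' * p * d" using K' p d by (intro mult_right_mono mult_left_mono) auto
    with Kpd have Kd: "K' * d \<le> 1 / 8" by simp
    obtain x v where x: "x 0 = d *\<^sub>R e" "\<And>T. caputo_path q x v T" "\<And>t. 0 < t \<Longrightarrow> caputo_op q v t = f (x t)"
      using global_solution[of "d *\<^sub>R e"] by metis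
    have x0: "norm (x 0) = d" "e \<bullet> x 0 = d" using e d by (auto simp: x(1) norm_eq_1)
    have xle: "norm (x t) < C * (2 * d) * exp (\<mu> * t)" if "0 < t" for t
    proof (rule growth[OF x(2)[of t]])
      show "x s \<bullet> caputo_op q v s \<le> k * (norm (x s))\<^sup>2" if "s \<in> {0<..t}" for s
        using energy[of "x s"] x(3)[of s] that by simp
    qed (use x0 d that in auto)
    \<comment> \<open>At this time \<open>d / 2 * exp (\<mu> * t) - K' * d\<^sup>2 * exp (2 * \<mu>
      * t)\<close> is maximal, with the value \<open>1 / (16 * K')\<close> independent of
      \<open>d\<close>.\<close>
    define s where "s = ln (1 / (4 * K' * d)) / \<mu>"
    have "1 < 1 / (4 * K' * d)" using Kd K' d by (simp add: field_simps)
    then have s: "0 < s" "exp (\<mu> * s) = 1 / (4 * K' * d)"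
      using \<mu> K' d by (auto simp: s_def)
    \<comment> \<open>The constant \<open>p * K' * d\<^sup>2\<close> compensates for the
      \<open>- 1\<close> in the lower bound for the derivative of
      \<open>exp (2 * \<mu> * t)\<close>.\<close>
    define H where "H t = (d / 2 * exp (\<mu> * t) + p * K' * d\<^sup>2) - (K' * d\<^sup>2 * exp (2 * \<mu> * t) + 0)" for t
    define h where "h t = d / 2 * (\<mu> * exp (\<mu> * t)) - K' * d\<^sup>2 * (2 * \<mu> * exp (2 * \<mu> * t))" for t
    note p1 = caputo_path_exp[OF q, of \<mu> s] and p2 = caputo_path_exp[OF q, of "2 * \<mu>" s]
    have p1': "caputo_path q (\<lambda>t. d / 2 * exp (\<mu> * t) + p * K' * d\<^sup>2) (\<lambda>t. d / 2 * (\<mu> * exp (\<mu> * t))) s"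
      by (rule caputo_path_scale_add[OF p1])
    have p2': "caputo_path q (\<lambda>t. K' * d\<^sup>2 * exp (2 * \<mu> * t) + 0) (\<lambda>t. K' * d\<^sup>2 * (2 * \<mu> * exp (2 * \<mu> * t))) s"
      by (rule caputo_path_scale_add[OF p2])
    have pathH: "caputo_path q H h s"
      unfolding H_def[abs_def] h_def[abs_def] by (rule caputo_path_diff[OF p1' p2'])
    have pathy: "caputo_path q (\<lambda>t. e \<bullet> x t) (\<lambda>t. e \<bullet> v t) s"
      by (rule caputo_path_linear[OF bounded_linear_inner_right x(2)])
    have "H s - e \<bullet> x s < 0"
    proof (rule caputo_neg_comparison[OF q caputo_path_diff[OF pathH pathy], of 0])
      show "H t - e \<bullet> x t < 0" if "t \<in> {0..s}" "t \<le> 0" for t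
      proof -
        have "t = 0" using that by simp
        have "H 0 = d / 2 + (K' * p * d - K' * d) * d" by (simp add: H_def algebra_simps power2_eq_square)
        also have "\<dots> \<le> d / 2 + 1 / 8 * d"
          using Kpd K' d by (intro add_left_mono mult_right_mono) (auto intro: order.trans[rotated])
        finally show ?thesis using x0 d \<open>t = 0\<close> by simp
      qed
      fix t assume t: "t \<in> {0<..s}" "H t - e \<bullet> x t = 0"
      define E where "E = exp (2 * \<mu> * t)"
      have E: "(exp (\<mu> * t))\<^sup>2 = E" by (simp add: E_def power2_eq_square exp_add[symmetric])
      have "caputo_op q h t = d / 2 * caputo_op q (\<lambda>t. \<mu> * exp (\<mu> * t)) t -
          K' * d\<^sup>2 * caputo_op q (\<lambda>t. 2 * \<mu> * exp (2 * \<mu> * t)) t"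
        unfolding h_def[abs_def] caputo_op_diff[OF p1' p2' t(1)]
          caputo_op_scale[OF p1 t(1)] caputo_op_scale[OF p2 t(1)] ..
      also have "\<dots> \<le> d / 2 * (k * exp (\<mu> * t)) - K' * d\<^sup>2 * (p * k * (E - 1))"
      proof (intro diff_mono mult_left_mono)
        show "caputo_op q (\<lambda>t. \<mu> * exp (\<mu> * t)) t \<le> k * exp (\<mu> * t)"
          using caputo_op_exp_le[OF q \<mu>(1), of t] t(1) \<mu>(2) by simp
        have "(2 * \<mu>) powr q = p * k" using \<mu> by (simp add: powr_mult p_def)
        then show "p * k * (E - 1) \<le> caputo_op q (\<lambda>t. 2 * \<mu> * exp (2 * \<mu> * t)) t"
          using caputo_op_exp_ge[OF q, of "2 * \<mu>" t] t(1) \<mu>(1) by (simp add: E_def)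
      qed (use d K' in auto)
      also have "\<dots> = k * H t - (K' * k * (p - 1)) * d\<^sup>2 * E"
        by (simp add: H_def E_def algebra_simps)
      also have "\<dots> \<le> k * H t - c * d\<^sup>2 * E"
        unfolding K'k by (intro diff_left_mono mult_right_mono) (auto simp: E_def)
      also have "\<dots> \<le> k * (e \<bullet> x t) - Q * (norm (x t))\<^sup>2"
      proof -
        have "(norm (x t))\<^sup>2 \<le> (C * (2 * d) * exp (\<mu> * t))\<^sup>2"
          using xle[of t] t(1) by (intro power_mono) auto
        also have "\<dots> = (2 * C)\<^sup>2 * d\<^sup>2 * E" by (simp add: power_mult_distrib E mult_ac)
        finally have "Q * (norm (x t))\<^sup>2 \<le> c * d\<^sup>2 * E"
          using mult_left_mono[OF _ Q(1)] by (fastforce simp: c_def mult.assoc)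
        then show ?thesis using t(2) by simp
      qed
      also have "\<dots> \<le> e \<bullet> f (x t)" by (rule Q(2))
      also have "\<dots> = caputo_op q (\<lambda>t. e \<bullet> v t) t"
        using caputo_op_linear[OF bounded_linear_inner_right x(2) t(1)] x(3)[of t] t(1) by simp
      finally show "caputo_op q (\<lambda>t. h t - e \<bullet> v t) t \<le> 0"
        unfolding caputo_op_diff[OF pathH pathy t(1)] by simp
    qed (use s in auto)
    moreover have "1 / (16 * K') \<le> H s"
    proof -
      have "exp (2 * \<mu> * s) = (exp (\<mu> * s))\<^sup>2" by (simp add: power2_eq_square exp_add[symmetric])
      then have "H s = 1 / (16 * K') + p * K' * d\<^sup>2"
        unfolding H_def s(2) using K' d by (simp add: field_simps power2_eq_square)
      then show ?thesis using p K' by simp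
    qed
    moreover have "e \<bullet> x s \<le> norm (x s)" using norm_cauchy_schwarz[of e "x s"] e by simp
    ultimately show "\<exists>x v t. norm (x 0) < \<delta> \<and> (\<forall>T. caputo_path q x v T) \<and>
        (\<forall>t>0. caputo_op q v t = f (x t)) \<and> 0 < t \<and> 1 / (16 * K') \<le> norm (x t)"
      using x x0 d s(1) by (intro exI[of _ x] exI[of _ v] exI[of _ s]) auto
  qed
qed

end

section \<open>The Stokes system\<close>

text \<open>Every open ball around 0 is invariant, so \<open>\<epsilon>\<close> itself serves as
  \<open>\<delta>\<close>; attraction holds from every initial value.\<close>

lemma caputo_dissipative_asymptotically_stable:
  fixes f :: "real ^ 'n \<Rightarrow> real ^ 'n"
  assumes q: "0 < q" "q < 1" and k: "k < 0" and energy: "\<And>u. u \<bullet> f u = k * (norm u)\<^sup>2"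
    and eq: "equilibrium_state f 0"
  shows "asymptotically_stable_equilibrium q f 0"
proof -
  have "norm (x t) < \<epsilon>" if "caputo_solution q f x" "norm (x 0) < \<epsilon>" "0 < t" for x \<epsilon> t
    using that energy unfolding caputo_solution_iff
    by (auto intro: caputo_dissipative_bound[OF q k])
  moreover have "((\<lambda>t. norm (x t)) \<longlongrightarrow> 0) at_top" if "caputo_solution q f x" for x
    using that energy unfolding caputo_solution_iff
    by (auto intro: caputo_dissipative_tendsto_0[OF q k])
  ultimately show ?thesis
    using eq unfolding asymptotically_stable_equilibrium_def stable_equilibrium_def
    by (auto intro: zero_less_one)
qed

section \<open>Algebra and derivative of the Stokes field\<close>

lemma inner_vec3: "(u :: real ^ 3) \<bullet> w = u $ 1 * w $ 1 + u $ 2 * w $ 2 + u $ 3 * w $ 3"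
  by (simp add: inner_vec_def sum_3)

lemma norm_vec3_le: "norm (u :: real ^ 3) \<le> \<bar>u $ 1\<bar> + \<bar>u $ 2\<bar> + \<bar>u $ 3\<bar>"
  using norm_le_l1_cart[of u] by (simp add: sum_3)

text \<open>The quadratic terms cancel because the three differences of the \<open>l\<close> sum to
  zero, and the rotation by \<open>b\<close> is orthogonal to \<open>u\<close>.\<close>

lemma stokes_field_energy: "u \<bullet> stokes_field l1 l2 l3 b1 b2 b3 k u = k * (norm u)\<^sup>2"
  by (simp add: power2_norm_eq_inner inner_vec3 stokes_field_def algebra_simps)

lemma stokes_field_equilibrium: "equilibrium_state (stokes_field l1 l2 l3 b1 b2 b3 k) 0"
  by (simp add: equilibrium_state_def stokes_field_def forall_3)

definition stokes_deriv ::
    "real \<Rightarrow> real \<Rightarrow> real \<Rightarrow> real \<Rightarrow> real \<Rightarrow> real \<Rightarrow> real \<Rightarrow> real ^ 3 \<Rightarrow> real ^ 3 \<Rightarrow> real ^ 3" where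
  "stokes_deriv l1 l2 l3 b1 b2 b3 k u h = vector
    [(l2 - l3) * (u $ 2 * h $ 3 + h $ 2 * u $ 3) + b2 * h $ 3 - b3 * h $ 2 + k * h $ 1,
     (l3 - l1) * (u $ 3 * h $ 1 + h $ 3 * u $ 1) + b3 * h $ 1 - b1 * h $ 3 + k * h $ 2,
     (l1 - l2) * (u $ 1 * h $ 2 + h $ 1 * u $ 2) + b1 * h $ 2 - b2 * h $ 1 + k * h $ 3]"

lemma stokes_field_has_derivative:
  "(stokes_field l1 l2 l3 b1 b2 b3 k has_derivative stokes_deriv l1 l2 l3 b1 b2 b3 k u) (at u)"
proof -
  have nth: "((\<lambda>u :: real ^ 3. u $ i) has_derivative (\<lambda>h. h $ i)) (at u)" for i
    by (rule bounded_linear.has_derivative[OF bounded_linear_vec_nth has_derivative_ident])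
  have "((\<lambda>u. stokes_field l1 l2 l3 b1 b2 b3 k u $ i) has_derivative
      (\<lambda>h. stokes_deriv l1 l2 l3 b1 b2 b3 k u h $ i)) (at u)" for i
    using exhaust_3[of i] unfolding stokes_field_def stokes_deriv_def
    by (auto intro!: derivative_eq_intros nth simp: fun_eq_iff algebra_simps)
  then show ?thesis
    by (subst has_derivative_componentwise_within) (auto simp: Basis_vec_def inner_axis)
qed

text \<open>The contributions of \<open>b\<close> and \<open>k\<close> do not depend on the base
  point and cancel; the rest is bilinear.\<close>

lemma stokes_deriv_lipschitz:
  "norm (stokes_deriv l1 l2 l3 b1 b2 b3 k u h - stokes_deriv l1 l2 l3 b1 b2 b3 k w h) \<le>
    2 * (\<bar>l2 - l3\<bar> + \<bar>l3 - l1\<bar> + \<bar>l1 - l2\<bar>) * norm (u - w) * norm h"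
proof -
  have bound: "\<bar>l * ((u - w) $ i * h $ j + h $ i * (u - w) $ j)\<bar> \<le> 2 * \<bar>l\<bar> * norm (u - w) * norm h" for l i j
  proof -
    have "\<bar>(u - w) $ i * h $ j + h $ i * (u - w) $ j\<bar> \<le>
        \<bar>(u - w) $ i\<bar> * \<bar>h $ j\<bar> + \<bar>h $ i\<bar> * \<bar>(u - w) $ j\<bar>"
      by (metis abs_triangle_ineq abs_mult)
    also have "\<dots> \<le> norm (u - w) * norm h + norm h * norm (u - w)"
      by (intro add_mono mult_mono component_le_norm_cart) auto
    finally have "\<bar>l\<bar> * \<bar>(u - w) $ i * h $ j + h $ i * (u - w) $ j\<bar> \<le> \<bar>l\<bar> * (2 * (norm (u - w) * norm h))"
      by (intro mult_left_mono) (auto simp: mult.commute)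
    then show ?thesis by (simp add: abs_mult mult_ac)
  qed
  define z where "z = stokes_deriv l1 l2 l3 b1 b2 b3 k u h - stokes_deriv l1 l2 l3 b1 b2 b3 k w h"
  have "z $ 1 = (l2 - l3) * ((u - w) $ 2 * h $ 3 + h $ 2 * (u - w) $ 3)"
    "z $ 2 = (l3 - l1) * ((u - w) $ 3 * h $ 1 + h $ 3 * (u - w) $ 1)"
    "z $ 3 = (l1 - l2) * ((u - w) $ 1 * h $ 2 + h $ 1 * (u - w) $ 2)"
    unfolding z_def stokes_deriv_def by (simp_all add: algebra_simps)
  then have "\<bar>z $ 1\<bar> + \<bar>z $ 2\<bar> + \<bar>z $ 3\<bar> \<le> 2 * \<bar>l2 - l3\<bar> * norm (u - w) * norm h +
      2 * \<bar>l3 - l1\<bar> * norm (u - w) * norm h + 2 * \<bar>l1 - l2\<bar> * norm (u - w) * norm h"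
    by (simp only:) (intro add_mono bound)
  with norm_vec3_le[of z] show ?thesis unfolding z_def by (simp add: algebra_simps)
qed

lemma stokes_linear_growth_field:
  assumes "0 < q" "q < 1" "0 < k"
  shows "linear_growth_field q k (2 * (\<bar>l2 - l3\<bar> + \<bar>l3 - l1\<bar> + \<bar>l1 - l2\<bar>)) (stokes_field l1 l2 l3 b1 b2 b3 k)
    (\<lambda>u. Blinfun (stokes_deriv l1 l2 l3 b1 b2 b3 k u))"
proof
  have app: "blinfun_apply (Blinfun (stokes_deriv l1 l2 l3 b1 b2 b3 k u)) = stokes_deriv l1 l2 l3 b1 b2 b3 k u" for u
    by (rule bounded_linear_Blinfun_apply[OF has_derivative_bounded_linear[OF stokes_field_has_derivative]])
  show "(stokes_field l1 l2 l3 b1 b2 b3 k has_derivative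
      blinfun_apply (Blinfun (stokes_deriv l1 l2 l3 b1 b2 b3 k u))) (at u)" for u
    unfolding app by (rule stokes_field_has_derivative)
  show "norm (Blinfun (stokes_deriv l1 l2 l3 b1 b2 b3 k u) - Blinfun (stokes_deriv l1 l2 l3 b1 b2 b3 k w)) \<le>
      2 * (\<bar>l2 - l3\<bar> + \<bar>l3 - l1\<bar> + \<bar>l1 - l2\<bar>) * norm (u - w)" for u w
    unfolding norm_blinfun.rep_eq blinfun.diff_left app
    by (rule onorm_bound[OF _ stokes_deriv_lipschitz]) auto
qed (use assms in \<open>auto simp: stokes_field_energy\<close>)

text \<open>
  The rotation \<open>b \<times> u\<close> is orthogonal to \<open>b\<close>, so along \<open>b\<close> the field is \<open>k * (b \<bullet> u)\<close> up to
  quadratic terms.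
\<close>

lemma stokes_field_along_b:
  fixes b1 b2 b3 :: real
  defines "b \<equiv> vector [b1, b2, b3] :: real ^ 3"
  shows "k * (b \<bullet> u) - (\<bar>b1 * (l2 - l3)\<bar> + \<bar>b2 * (l3 - l1)\<bar> + \<bar>b3 * (l1 - l2)\<bar>) * (norm u)\<^sup>2 \<le>
    b \<bullet> stokes_field l1 l2 l3 b1 b2 b3 k u"
proof -
  have bound: "\<bar>c * (u $ i * u $ j)\<bar> \<le> \<bar>c\<bar> * (norm u)\<^sup>2" for c i j
    unfolding abs_mult power2_eq_square by (intro mult_left_mono mult_mono component_le_norm_cart) auto
  have "b \<bullet> stokes_field l1 l2 l3 b1 b2 b3 k u = k * (b \<bullet> u) + b1 * (l2 - l3) * (u $ 2 * u $ 3) +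
      b2 * (l3 - l1) * (u $ 3 * u $ 1) + b3 * (l1 - l2) * (u $ 1 * u $ 2)"
    by (simp add: b_def inner_vec3 stokes_field_def algebra_simps)
  then show ?thesis
    using bound[of "b1 * (l2 - l3)" 2 3] bound[of "b2 * (l3 - l1)" 3 1] bound[of "b3 * (l1 - l2)" 1 2]
    by (simp only: distrib_right abs_le_iff) linarith
qed

text \<open>The level reached by the escaping solutions does not depend on \<open>\<delta>\<close>,
  which contradicts stability directly. \<open>b1 \<noteq> 0\<close> allows \<open>b\<close> to be
  normalised.\<close>

lemma stokes_field_unstable:
  assumes q: "0 < q" "q < 1" and k: "0 < k" and "b1 \<noteq> 0"
  shows "unstable_equilibrium q (stokes_field l1 l2 l3 b1 b2 b3 k) 0"
proof -
  define f where "f = stokes_field l1 l2 l3 b1 b2 b3 k"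
  interpret linear_growth_field q k "2 * (\<bar>l2 - l3\<bar> + \<bar>l3 - l1\<bar> + \<bar>l1 - l2\<bar>)" f
      "\<lambda>u. Blinfun (stokes_deriv l1 l2 l3 b1 b2 b3 k u)"
    unfolding f_def by (rule stokes_linear_growth_field[OF q k])
  define b :: "real ^ 3" where "b = vector [b1, b2, b3]"
  have "b $ 1 \<noteq> 0" using \<open>b1 \<noteq> 0\<close> by (simp add: b_def)
  then have b: "0 < norm b" by auto
  define Q where "Q = \<bar>b1 * (l2 - l3)\<bar> + \<bar>b2 * (l3 - l1)\<bar> + \<bar>b3 * (l1 - l2)\<bar>"
  have "k * ((b /\<^sub>R norm b) \<bullet> u) - Q / norm b * (norm u)\<^sup>2 \<le> (b /\<^sub>R norm b) \<bullet> f u" for u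
  proof -
    have "(k * (b \<bullet> u) - Q * (norm u)\<^sup>2) / norm b \<le> (b \<bullet> f u) / norm b"
      using stokes_field_along_b b unfolding b_def f_def Q_def by (intro divide_right_mono) auto
    then show ?thesis by (simp add: divide_inverse algebra_simps)
  qed
  moreover have "norm (b /\<^sub>R norm b) = 1" using b by simp
  moreover have "0 \<le> Q / norm b" by (simp add: Q_def)
  ultimately obtain \<epsilon> where \<epsilon>: "0 < \<epsilon>" "\<And>\<delta>. 0 < \<delta> \<Longrightarrow> \<exists>x v t. norm (x 0) < \<delta> \<and>
      (\<forall>T. caputo_path q x v T) \<and> (\<forall>t>0. caputo_op q v t = f (x t)) \<and> 0 < t \<and> \<epsilon> \<le> norm (x t)"
    using escaping_solutions by metis
  have "\<not> stable_equilibrium q f 0"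
  proof
    assume "stable_equilibrium q f 0"
    then obtain \<delta> where "0 < \<delta>" and \<delta>: "\<And>x t. \<lbrakk>caputo_solution q f x; norm (x 0) < \<delta>; 0 < t\<rbrakk> \<Longrightarrow> norm (x t) < \<epsilon>"
      using \<epsilon>(1) unfolding stable_equilibrium_def by (metis diff_zero)
    from \<epsilon>(2)[OF \<open>0 < \<delta>\<close>] obtain x v t where "norm (x 0) < \<delta>" "\<forall>T. caputo_path q x v T"
        "\<forall>t>0. caputo_op q v t = f (x t)" "0 < t" "\<epsilon> \<le> norm (x t)"
      by blast
    with \<delta>[of x t] show False unfolding caputo_solution_iff by fastforce
  qed
  then show ?thesis
    using stokes_field_equilibrium by (auto simp: unstable_equilibrium_def f_def)
qed

theorem theorem4p3:
  fixes l1 l2 l3 b1 b2 b3 k4 :: real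
  assumes "l1 \<noteq> l2" and "l2 \<noteq> l3" and "l1 \<noteq> l3"
    and "b1 \<noteq> 0" and "b2 \<noteq> 0" and "b3 \<noteq> 0"
    and "k4 \<noteq> 0"
  shows "(k4 < 0 \<longrightarrow>
            (\<forall>q\<in>{0<..<1}. asymptotically_stable_equilibrium q
                              (stokes_field l1 l2 l3 b1 b2 b3 k4) 0)) \<and>
         (k4 > 0 \<longrightarrow>
            (\<forall>q\<in>{0<..<1}. unstable_equilibrium q
                              (stokes_field l1 l2 l3 b1 b2 b3 k4) 0))"
  using caputo_dissipative_asymptotically_stable[OF _ _ _ stokes_field_energy stokes_field_equilibrium]
    stokes_field_unstable \<open>b1 \<noteq> 0\<close>
  by auto

end
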